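(* Let $\Lambda$ be an open subset of $\mathbb{R}^d$ and consider a continuous family $\{f_\mu\}_{\mu\in\Lambda}$ of analytic functions on $[0,+\infty)$. Assume that, in a neighborhood of some fixed $\hat\mu\in\Lambda$, there exist $n\ge0$ continuous functions $\nu_1,\nu_2,\dots,\nu_n$, with $\nu_1(\hat\mu),\dots,\nu_n(\hat\mu)$ pairwise distinct, and $m\in\mathbb{N}\cup\{0\}$ such that $$\mathscr L_{\boldsymbol\nu_n(\mu)}[f_\mu](x)\sim_\infty a(\mu)x^{\alpha(\mu)}\quad\text{at }\hat\mu,\qquad\text{with }\alpha(\hat\mu)+2m=-1.$$ If $M_1[\mathscr L_{\boldsymbol\nu_n(\mu)}[f_\mu]]\equiv M_2[\mathscr L_{\boldsymbol\nu_n(\mu)}[f_\mu]]\equiv\cdots\equiv M_m[\mathscr L_{\boldsymbol\nu_n(\mu)}[f_\mu]]\equiv0$ (identically as functions of $\mu$), then $$x^{2m+1}(\mathscr L_{\boldsymbol\nu_n(\mu)}\circ\mathscr F)[f_\mu](x)\sim_\infty a(\mu)\,b_m(\alpha(\mu))\,\Omega(x,\alpha(\mu)+2m)\quad\text{at }\hat\mu.$$ (The condition on the existence of the functions $\nu_i$ is void if $n=0$, and the condition on the momenta is void if $m=0$.)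
   Context: $\mathbb{N}=\{1,2,\dots\}$. An analytic function on $[0,+\infty)$ (the class $C^\omega[0,+\infty)$) is an analytic function on $(0,+\infty)$ that extends analytically to $x=0$. A family $\{f_\mu\}$ is continuous if $(x,\mu)\mapsto f_\mu(x)$ is continuous. Operators: $\mathscr F[f](x):=\int_0^{\pi/2}f(x\sin\theta)\,d\theta$. For $\boldsymbol\nu_n=(\nu_1,\dots,\nu_n)\in\mathbb{R}^n$, $$\mathscr L_{\boldsymbol\nu_n}[f](x):=\frac{W[x^{\nu_1},x^{\nu_2},\dots,x^{\nu_n},f(x)]}{x^{\sum_{i=1}^n(\nu_i-i)}},$$ where $W[f_0,\dots,f_{k-1}](x)=\det\bigl(f_j^{(i)}(x)\bigr)_{0\le i,j\le k-1}$ is the Wronskian, and $\mathscr L_{\boldsymbol\nu_0}:=\mathrm{id}$. When the $\nu_i$ are functions of $\mu$, $\boldsymbol\nu_n(\mu)=(\nu_1(\mu),\dots,\nu_n(\mu))$. (If $f\in C^\omega[0,+\infty)$ then $\mathscr L_{\boldsymbol\nu_n}[f]\in C^\omega[0,+\infty)$.) Momenta: $M_n[f]:=\int_0^{+\infty}x^{2n-2}f(x)\,dx$ for $n\in\mathbb{N}$, whenever well defined. $b_0(\alpha)\equiv1$ and $b_m(\alpha):=\prod_{i=1}^m\frac{\alpha+2i}{\alpha+2i-1}$ for $m\ge1$. Quantification by powers: for a continuous family $\{F_\mu\}$, $F_\mu(x)\sim_\infty a(\mu)x^{\alpha(\mu)}$ at $\hat\mu$ means that there is an open neighborhood $U$ of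 $\hat\mu$ such that for each $\mu\in U$, $\lim_{x\to+\infty}F_\mu(x)x^{-\alpha(\mu)}=a(\mu)\ne0$, and moreover $\lim_{(x,\mu)\to(+\infty,\hat\mu)}F_\mu(x)x^{-\alpha(\mu)}=a(\hat\mu)\neq0$. Compensator: $\omega(x,\alpha):=\frac{x^{\alpha+1}-1}{\alpha+1}$ if $\alpha\ne-1$ and $\omega(x,-1):=\log x$, for $x>0$. Let $\mathscr G(\alpha):=\frac{\sqrt\pi}{2}\frac{\Gamma(\frac{1+\alpha}{2})}{\Gamma(1+\frac\alpha2)}$ ($\Gamma$ the Gamma function) and $\Omega(x,\alpha):=(\alpha+1)\mathscr G(\alpha)\omega(x,\alpha)$, where $(\alpha+1)\mathscr G(\alpha)=\sqrt\pi\,\Gamma(\frac{3+\alpha}{2})/\Gamma(1+\frac\alpha2)$ is continuously extended to $\alpha=-1$ with value $1$ (so $\Omega(x,-1)=\log x$). Quantification by $\Omega$: for a continuous family $\{F_\mu\}$ and a function $\beta(\mu)$, $F_\mu(x)\sim_\infty\ell(\mu)\Omega(x,\beta(\mu))$ at $\hat\mu$ means $\lim_{(x,\mu)\to(+\infty,\hat\mu)}\frac{F_\mu(x)}{\Omega(x,\beta(\mu))}=\ell(\hat\mu)\ne0$. *)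

theory Defs
  imports "HOL-Analysis.Analysis" "Jordan_Normal_Form.Determinant"
begin

text \<open>Functions on the half-line $[0,+\infty)$ are represented by total functions on the reals whose
  values at negative arguments are irrelevant. At the endpoint \<open>x0 = 0\<close> the expansion below is only
  required for \<open>x \<ge> 0\<close>; its power series then converges on a two-sided neighbourhood of 0 and gives
  the analytic extension.\<close>

definition analytic_half_line :: "(real \<Rightarrow> real) \<Rightarrow> bool" where
  "analytic_half_line f \<longleftrightarrow>
     (\<forall>x0\<ge>0. \<exists>c r. r > 0 \<and>
        (\<forall>x\<ge>0. \<bar>x - x0\<bar> < r \<longrightarrow> (\<lambda>k. c k * (x - x0) ^ k) sums f x))"

definition continuous_family_on :: "'p::topological_space set \<Rightarrow> ('p \<Rightarrow> real \<Rightarrow> real) \<Rightarrow> bool" where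
  "continuous_family_on U F \<longleftrightarrow> continuous_on ({0..} \<times> U) (\<lambda>(x, \<mu>). F \<mu> x)"

definition F_op :: "(real \<Rightarrow> real) \<Rightarrow> real \<Rightarrow> real" where
  "F_op f x = integral {0..pi / 2} (\<lambda>\<theta>. f (x * sin \<theta>))"

definition wronskian :: "(real \<Rightarrow> real) list \<Rightarrow> real \<Rightarrow> real" where
  "wronskian fs x =
     Determinant.det (Matrix.mat (length fs) (length fs) (\<lambda>(i, j). (deriv ^^ i) (fs ! j) x))"

text \<open>The quotient by which the operator is given.  It is meaningful for \<open>x > 0\<close>.  The shift
  \<open>Suc i\<close> appears because list indices start at 0.\<close>

definition L_quotient :: "real list \<Rightarrow> (real \<Rightarrow> real) \<Rightarrow> real \<Rightarrow> real" where
  "L_quotient \<nu>s f x =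
     wronskian (map (\<lambda>\<nu> t. t powr \<nu>) \<nu>s @ [f]) x
       / x powr (\<Sum>i<length \<nu>s. \<nu>s ! i - real (Suc i))"

text \<open>For \<open>f\<close> analytic on $[0,+\infty)$ the quotient extends analytically to \<open>x = 0\<close>; the value there
  is the one of this extension, i.e. the limit from the right.\<close>

definition L_op :: "real list \<Rightarrow> (real \<Rightarrow> real) \<Rightarrow> real \<Rightarrow> real" where
  "L_op \<nu>s f =
     (if \<nu>s = [] then f
      else (\<lambda>x. if x = 0 then Lim (at_right 0) (L_quotient \<nu>s f) else L_quotient \<nu>s f x))"

text \<open>Momenta are used for \<open>n \<ge> 1\<close> only.  The gauge integral over the half-line also
  covers conditionally convergent improper integrals.\<close>

definition momentum_exists :: "nat \<Rightarrow> (real \<Rightarrow> real) \<Rightarrow> bool" where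
  "momentum_exists n f \<longleftrightarrow> (\<lambda>x. x ^ (2 * n - 2) * f x) integrable_on {0..}"

definition momentum :: "nat \<Rightarrow> (real \<Rightarrow> real) \<Rightarrow> real" where
  "momentum n f = integral {0..} (\<lambda>x. x ^ (2 * n - 2) * f x)"

definition b_coeff :: "nat \<Rightarrow> real \<Rightarrow> real" where
  "b_coeff m \<alpha> = (\<Prod>i=1..m. (\<alpha> + 2 * real i) / (\<alpha> + 2 * real i - 1))"

definition compensator :: "real \<Rightarrow> real \<Rightarrow> real" where
  "compensator x \<alpha> = (if \<alpha> = -1 then ln x else (x powr (\<alpha> + 1) - 1) / (\<alpha> + 1))"

definition G_fun :: "real \<Rightarrow> real" where
  "G_fun \<alpha> = sqrt pi / 2 * (Gamma ((1 + \<alpha>) / 2) / Gamma (1 + \<alpha> / 2))"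

text \<open>The factor \<open>(\<alpha> + 1) * G_fun \<alpha>\<close> has a removable singularity at \<open>\<alpha> = -1\<close>, with value 1.\<close>

definition Omega :: "real \<Rightarrow> real \<Rightarrow> real" where
  "Omega x \<alpha> = (if \<alpha> = -1 then 1 else (\<alpha> + 1) * G_fun \<alpha>) * compensator x \<alpha>"

text \<open>Both quantifications are notions for continuous families, so they include that the family is
  continuous (jointly in \<open>x \<ge> 0\<close> and the parameter) near the parameter \<open>\<mu>0\<close>.\<close>

definition quantified_by_power ::
    "('p::topological_space \<Rightarrow> real \<Rightarrow> real) \<Rightarrow> ('p \<Rightarrow> real) \<Rightarrow> ('p \<Rightarrow> real) \<Rightarrow> 'p \<Rightarrow> bool" where
  "quantified_by_power F a \<alpha> \<mu>0 \<longleftrightarrow>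
     (\<exists>U. open U \<and> \<mu>0 \<in> U \<and> continuous_family_on U F \<and>
        (\<forall>\<mu>\<in>U. ((\<lambda>x. F \<mu> x * x powr (- \<alpha> \<mu>)) \<longlongrightarrow> a \<mu>) at_top \<and> a \<mu> \<noteq> 0)) \<and>
     ((\<lambda>(x, \<mu>). F \<mu> x * x powr (- \<alpha> \<mu>)) \<longlongrightarrow> a \<mu>0) (at_top \<times>\<^sub>F nhds \<mu>0) \<and> a \<mu>0 \<noteq> 0"

definition quantified_by_Omega ::
    "('p::topological_space \<Rightarrow> real \<Rightarrow> real) \<Rightarrow> ('p \<Rightarrow> real) \<Rightarrow> ('p \<Rightarrow> real) \<Rightarrow> 'p \<Rightarrow> bool" where
  "quantified_by_Omega F l \<beta> \<mu>0 \<longleftrightarrow>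
     (\<exists>U. open U \<and> \<mu>0 \<in> U \<and> continuous_family_on U F) \<and>
     ((\<lambda>(x, \<mu>). F \<mu> x / Omega x (\<beta> \<mu>)) \<longlongrightarrow> l \<mu>0) (at_top \<times>\<^sub>F nhds \<mu>0) \<and> l \<mu>0 \<noteq> 0"

end

theory Submission
  imports Defs
begin

text \<open>
  Pulling the powers of \<open>x\<close> out of the columns and rows of the Wronskian shows that the operator
  $\mathscr L_{\boldsymbol\nu}$ is an Euler operator $\sum_i C_i(\boldsymbol\nu)\, x^i d^i/dx^i$.
  Differentiation under the integral sign shows that every $x^i d^i/dx^i$ commutes with $\mathscr F$,
  so it is enough to study $\mathscr F[g_\mu]$ for $g_\mu = \mathscr L_{\boldsymbol\nu}[f_\mu]$.

  Truncating the binomial series of $(1-u^2)^{-1/2}$ at $u = \sin\theta$ gives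
  $1 = \cos\theta \sum_{k\le m} c_k \sin^{2k}\theta + O(\sin^{2m+2}\theta)$ with
  $c_k = \binom{2k}{k} 4^{-k}$, and the substitution $s = x \sin\theta$ turns this into
  $$x^{2m+1}\mathscr F[g](x) = \sum_{k\le m} c_k x^{2(m-k)} \int_0^x s^{2k} g(s)\,ds +
    O\Bigl(\frac1x \sup_{s\le x} s^{2m+2} |g(s)|\Bigr).$$
  Put $\beta = \alpha + 2m$, which is close to $-1$. The terms with $k < m$ are tails of vanishing
  momenta, hence $O(x^{\beta+1})$, and so is the error up to a constant. Since
  $x^{\beta+1} = 1 + (\beta+1)\,\omega(x,\beta)$, these are negligible against $\omega(x,\beta)$,
  which tends to infinity. The term $k = m$ is asymptotic to
  $c_m\, a \int_1^x s^\beta ds = c_m\, a\, \omega(x,\beta)$, and $c_m = b_m(-1-2m)$.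
\<close>

section \<open>The operators commute\<close>

lemma at_within_half_line_neq_bot: "x \<ge> (0::real) \<Longrightarrow> at x within {0..} \<noteq> bot"
  using islimpt_Icc[of x "x+1" x] islimpt_subset[of x "{x..x+1}" "{0..}"]
  by (auto simp: trivial_limit_within)

lemma at_within_half_line_interior: "x > (0::real) \<Longrightarrow> at x within {0..} = at x"
  by (rule at_within_interior) (simp add: interior_real_atLeast)

text \<open>The local power series are differentiated term by term. Derivatives are taken within the
  half-line, where they are unique even at 0, so the locally found derivatives are values of one
  global function.\<close>

lemma analytic_half_line_derivative:
  assumes "analytic_half_line f"
  obtains f' where "analytic_half_line f'"
    "\<And>x. x \<ge> 0 \<Longrightarrow> (f has_real_derivative f' x) (at x within {0..})"
proof -
  define f' where "f' x = vector_derivative f (at x within {0..})" for x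
  have local: "\<exists>c r. r > 0 \<and> (\<forall>x\<ge>0. \<bar>x - x0\<bar> < r \<longrightarrow>
      (f has_real_derivative (\<Sum>n. diffs c n * (x - x0) ^ n)) (at x within {0..}) \<and>
      summable (\<lambda>n. diffs c n * (x - x0) ^ n))" if "x0 \<ge> 0" for x0
  proof -
    from assms that obtain c r where r: "r > 0"
      and "\<forall>x\<ge>0. \<bar>x - x0\<bar> < r \<longrightarrow> (\<lambda>k. c k * (x - x0) ^ k) sums f x"
      unfolding analytic_half_line_def by auto
    then have c: "(\<lambda>k. c k * (x - x0) ^ k) sums f x" if "x \<ge> 0" "\<bar>x - x0\<bar> < r" for x
      using that by simp
    \<comment> \<open>The expansion is given only at nonnegative points. Convergence at
      \<open>x0 + \<rho>\<close>, to the right of \<open>x0\<close> and with |z| < \<rho> < r,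
      forces convergence at z of either sign.\<close>
    have sm: "summable (\<lambda>k. c k * z ^ k)" if "norm z < r" for z :: real
    proof -
      define \<rho> where "\<rho> = (\<bar>z\<bar> + r) / 2"
      have "summable (\<lambda>k. c k * \<rho> ^ k)"
        using c[of "x0 + \<rho>"] that r \<open>x0 \<ge> 0\<close> by (auto simp: \<rho>_def sums_iff)
      then show ?thesis
        by (rule powser_inside) (use that in \<open>auto simp: \<rho>_def\<close>)
    qed
    have "(f has_real_derivative (\<Sum>n. diffs c n * (x - x0) ^ n)) (at x within {0..}) \<and>
        summable (\<lambda>n. diffs c n * (x - x0) ^ n)" if x: "x \<ge> 0" "\<bar>x - x0\<bar> < r" for x
    proof
      have "((\<lambda>z. \<Sum>n. c n * z^n) has_field_derivative (\<Sum>n. diffs c n * (x - x0)^n)) (at (x - x0))"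
        by (rule termdiffs_strong'[OF sm]) (use x in auto)
      then have "((\<lambda>y. \<Sum>n. c n * (y - x0)^n) has_field_derivative (\<Sum>n. diffs c n * (x - x0)^n)) (at x)"
        using DERIV_shift[of _ _ x "- x0"] by simp
      then have "((\<lambda>y. \<Sum>n. c n * (y - x0)^n) has_field_derivative (\<Sum>n. diffs c n * (x - x0)^n))
          (at x within {0..})"
        by (rule has_field_derivative_at_within)
      moreover have "\<forall>\<^sub>F y in at x within {0..}. \<bar>y - x0\<bar> < r \<and> y \<ge> 0"
      proof (rule eventually_conj)
        have "((\<lambda>y. \<bar>y - x0\<bar>) \<longlongrightarrow> \<bar>x - x0\<bar>) (at x within {0..})"
          by (intro tendsto_intros)
        then show "\<forall>\<^sub>F y in at x within {0..}. \<bar>y - x0\<bar> < r"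
          using x(2) order_tendstoD(2) by blast
      qed (simp add: eventually_at_filter)
      then have "\<forall>\<^sub>F y in at x within {0..}. (\<Sum>n. c n * (y - x0)^n) = f y"
        by eventually_elim (use c in \<open>auto simp: sums_iff\<close>)
      moreover have "(\<Sum>n. c n * (x - x0)^n) = f x"
        using c x by (auto simp: sums_iff)
      ultimately show "(f has_real_derivative (\<Sum>n. diffs c n * (x - x0) ^ n)) (at x within {0..})"
        using has_field_derivative_cong_eventually[of "\<lambda>y. \<Sum>n. c n * (y - x0)^n" f x "{0..}"] by simp
    qed (rule termdiff_converges[of _ r], use x sm in auto)
    then show ?thesis using r by blast
  qed
  have eq: "f' x = D" if "(f has_real_derivative D) (at x within {0..})" "x \<ge> 0" for x D
    unfolding f'_def
    by (rule vector_derivative_within[OF at_within_half_line_neq_bot])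
      (use that in \<open>auto simp: has_real_derivative_iff_has_vector_derivative\<close>)
  show thesis
  proof
    show "analytic_half_line f'"
      unfolding analytic_half_line_def
    proof (intro allI impI)
      fix x0 :: real assume "x0 \<ge> 0"
      from local[OF this] obtain c r where "r > 0"
        and *: "\<forall>x\<ge>0. \<bar>x - x0\<bar> < r \<longrightarrow>
          (f has_real_derivative (\<Sum>n. diffs c n * (x - x0) ^ n)) (at x within {0..}) \<and>
          summable (\<lambda>n. diffs c n * (x - x0) ^ n)"
        by auto
      have "(\<lambda>k. diffs c k * (x - x0) ^ k) sums f' x" if "x \<ge> 0" "\<bar>x - x0\<bar> < r" for x
        using eq[of "\<Sum>n. diffs c n * (x - x0) ^ n" x] * that by (simp add: sums_iff)
      then show "\<exists>c r. r > 0 \<and>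
        (\<forall>x\<ge>0. \<bar>x - x0\<bar> < r \<longrightarrow> (\<lambda>k. c k * (x - x0) ^ k) sums f' x)"
        using \<open>r > 0\<close> by (intro exI[of _ "diffs c"] exI[of _ r]) auto
    qed
    show "(f has_real_derivative f' x) (at x within {0..})" if x: "x \<ge> 0" for x
    proof -
      obtain D where "(f has_real_derivative D) (at x within {0..})"
        using local[OF x] x by fastforce
      then show ?thesis using eq x by blast
    qed
  qed
qed

text \<open>At 0 only one-sided derivatives make sense, since the values at negative arguments are junk.\<close>

definition half_line_derivs :: "(nat \<Rightarrow> real \<Rightarrow> real) \<Rightarrow> bool" where
  "half_line_derivs h \<longleftrightarrow>
     (\<forall>k. \<forall>x\<ge>0. (h k has_real_derivative h (Suc k) x) (at x within {0..}))"

text \<open>Dependent choice repeats the differentiation. Analyticity belongs to the invariant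
  because it is what provides the next derivative.\<close>

lemma analytic_half_line_derivs:
  assumes "analytic_half_line f"
  obtains h where "h 0 = f" "half_line_derivs h"
proof -
  have "\<exists>h. \<forall>k. (analytic_half_line (h k) \<and> (k = 0 \<longrightarrow> h k = f)) \<and>
      (\<forall>x\<ge>0. (h k has_real_derivative h (Suc k) x) (at x within {0..}))"
  proof (rule dependent_nat_choice)
    show "\<exists>g. analytic_half_line g \<and> (0 = (0::nat) \<longrightarrow> g = f)"
      using assms by auto
    show "\<exists>g'. (analytic_half_line g' \<and> (Suc k = 0 \<longrightarrow> g' = f)) \<and>
        (\<forall>x\<ge>0. (g has_real_derivative g' x) (at x within {0..}))"
      if g: "analytic_half_line g \<and> (k = 0 \<longrightarrow> g = f)" for g and k :: nat
    proof -
      obtain g' where "analytic_half_line g'"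
        "\<And>x. x \<ge> 0 \<Longrightarrow> (g has_real_derivative g' x) (at x within {0..})"
        using analytic_half_line_derivative g by blast
      then show ?thesis by (intro exI[of _ g']) simp
    qed
  qed
  then obtain h where "\<forall>k. (analytic_half_line (h k) \<and> (k = 0 \<longrightarrow> h k = f)) \<and>
      (\<forall>x\<ge>0. (h k has_real_derivative h (Suc k) x) (at x within {0..}))" by blast
  then show thesis using that[of h] unfolding half_line_derivs_def by simp
qed

lemma half_line_derivs_continuous: "half_line_derivs h \<Longrightarrow> continuous_on {0..} (h k)"
  unfolding half_line_derivs_def
  by (intro DERIV_continuous_on) auto

text \<open>This links the two-sided \<open>deriv\<close> of the Wronskian to a given sequence of
  derivatives. The induction runs over all x > 0 at once, because the derivative at x needs the
  previous equality in a whole neighbourhood of x.\<close>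

lemma funpow_deriv_on_pos:
  fixes h :: "nat \<Rightarrow> real \<Rightarrow> real"
  assumes h: "\<And>k x. x > 0 \<Longrightarrow> (h k has_real_derivative h (Suc k) x) (at x)"
    and f: "\<And>x. x > 0 \<Longrightarrow> f x = h 0 x" and "x > 0"
  shows "(deriv ^^ k) f x = h k x"
  using \<open>x > 0\<close>
proof (induction k arbitrary: x)
  case (Suc k)
  have "\<forall>\<^sub>F y in nhds x. (deriv ^^ k) f y = h k y"
    using Suc by (auto intro!: eventually_nhds_in_open[of "{0<..}" x, THEN eventually_mono])
  then have "deriv ((deriv ^^ k) f) x = deriv (h k) x"
    by (intro deriv_cong_ev) auto
  also have "\<dots> = h (Suc k) x"
    by (intro DERIV_imp_deriv h Suc.prems)
  finally show ?case by simp
qed (use f in simp)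

lemma half_line_derivs_at:
  "half_line_derivs h \<Longrightarrow> x > 0 \<Longrightarrow> (h k has_real_derivative h (Suc k) x) (at x)"
  unfolding half_line_derivs_def
  using at_within_half_line_interior[of x] by (metis less_imp_le)

lemma funpow_deriv_powr:
  assumes "x > 0"
  shows "(deriv ^^ k) (\<lambda>t. t powr \<nu>) x = (\<Prod>i<k. \<nu> - real i) * x powr (\<nu> - real k)"
proof (rule funpow_deriv_on_pos[where h = "\<lambda>k x. (\<Prod>i<k. \<nu> - real i) * x powr (\<nu> - real k)"])
  fix k x assume "x > (0::real)"
  then show "((\<lambda>x. (\<Prod>i<k. \<nu> - real i) * x powr (\<nu> - real k)) has_real_derivative
      (\<Prod>i<Suc k. \<nu> - real i) * x powr (\<nu> - real (Suc k))) (at x)"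
    by (auto intro!: derivative_eq_intros simp: algebra_simps)
qed (use assms in auto)

section \<open>Differentiation under the integral sign\<close>

definition F_deriv :: "(nat \<Rightarrow> real \<Rightarrow> real) \<Rightarrow> nat \<Rightarrow> real \<Rightarrow> real" where
  "F_deriv h k x = integral {0..pi/2} (\<lambda>\<theta>. sin \<theta> ^ k * h k (x * sin \<theta>))"

lemma sin_nonneg_quarter: "\<theta> \<in> {0..pi/2} \<Longrightarrow> sin \<theta> \<ge> 0"
  using sin_ge_zero[of \<theta>] pi_ge_zero by auto

lemma continuous_on_sin_scale:
  assumes "continuous_on {0..} g"
  shows "continuous_on ({0..} \<times> {0..pi/2}) (\<lambda>(x, \<theta>). sin \<theta> ^ k * g (x * sin \<theta>))"
  unfolding case_prod_unfold
  by (intro continuous_intros continuous_on_compose2[OF assms])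
    (auto intro!: mult_nonneg_nonneg sin_nonneg_quarter)

lemma half_line_derivs_F_deriv:
  assumes "half_line_derivs h"
  shows "half_line_derivs (F_deriv h)"
  unfolding half_line_derivs_def
proof (intro allI impI)
  fix k and x :: real assume "x \<ge> 0"
  have "((\<lambda>x. integral (cbox 0 (pi/2)) (\<lambda>\<theta>. sin \<theta> ^ k * h k (x * sin \<theta>))) has_field_derivative
      integral (cbox 0 (pi/2)) (\<lambda>\<theta>. sin \<theta> ^ Suc k * h (Suc k) (x * sin \<theta>))) (at x within {0..})"
  proof (rule leibniz_rule_field_derivative)
    fix x \<theta> :: real assume x: "x \<in> {0..}" and \<theta>: "\<theta> \<in> cbox 0 (pi/2)"
    have "(h k has_real_derivative h (Suc k) (x * sin \<theta>)) (at (x * sin \<theta>) within {0..})"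
      using assms x sin_nonneg_quarter[of \<theta>] \<theta> by (auto simp: half_line_derivs_def)
    \<comment> \<open>Since sin \<theta> is nonnegative on the quarter period, the dilation by sin
      \<theta> maps the half-line into itself, so the chain rule works with one-sided
      derivatives.\<close>
    then have "(h k has_real_derivative h (Suc k) (x * sin \<theta>))
        (at (x * sin \<theta>) within (\<lambda>x. x * sin \<theta>) ` {0..})"
      by (rule DERIV_subset) (use sin_nonneg_quarter[of \<theta>] \<theta> in auto)
    then have "(h k \<circ> (\<lambda>x. x * sin \<theta>) has_real_derivative h (Suc k) (x * sin \<theta>) * sin \<theta>) (at x within {0..})"
      by (rule DERIV_image_chain) (auto intro!: derivative_eq_intros)
    then show "((\<lambda>x. sin \<theta> ^ k * h k (x * sin \<theta>)) has_real_derivative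
        sin \<theta> ^ Suc k * h (Suc k) (x * sin \<theta>)) (at x within {0..})"
      by (auto intro!: derivative_eq_intros simp: o_def)
  next
    fix x :: real assume "x \<in> {0..}"
    then show "(\<lambda>\<theta>. sin \<theta> ^ k * h k (x * sin \<theta>)) integrable_on cbox 0 (pi/2)"
      by (intro integrable_continuous continuous_intros
          continuous_on_compose2[OF half_line_derivs_continuous[OF assms]])
        (auto intro!: mult_nonneg_nonneg sin_nonneg_quarter)
  next
    show "continuous_on ({0..} \<times> cbox 0 (pi/2)) (\<lambda>(x, \<theta>). sin \<theta> ^ Suc k * h (Suc k) (x * sin \<theta>))"
      using continuous_on_sin_scale[OF half_line_derivs_continuous[OF assms], of "Suc k" "Suc k"]
      by simp
  qed (use \<open>x \<ge> 0\<close> in auto)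
  then show "(F_deriv h k has_real_derivative F_deriv h (Suc k) x) (at x within {0..})"
    by (simp add: F_deriv_def[abs_def])
qed

text \<open>The scaled matrix is the product of diag(r), A and diag(c), and the determinant is
  multiplicative.\<close>

lemma det_scale_rows_cols:
  fixes A :: "real mat"
  assumes A: "A \<in> carrier_mat n n"
  shows "Determinant.det (Matrix.mat n n (\<lambda>(i, j). r i * A $$ (i, j) * c j)) =
    (\<Prod>i<n. r i) * (\<Prod>j<n. c j) * Determinant.det A"
proof -
  define R where "R = Matrix.mat n n (\<lambda>(i, j). if i = j then r i else 0)"
  define C where "C = Matrix.mat n n (\<lambda>(i, j). if i = j then c i else 0)"
  have RC: "R \<in> carrier_mat n n" "C \<in> carrier_mat n n" by (auto simp: R_def C_def)
  have "Matrix.mat n n (\<lambda>(i, j). r i * A $$ (i, j) * c j) = R * A * C"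
    using A by (auto intro!: eq_matI simp: R_def C_def scalar_prod_def if_distrib[of "\<lambda>x. x * _"] if_distrib[of "\<lambda>x. _ * x"] sum.delta cong: if_cong)
  moreover have "Determinant.det R = (\<Prod>i<n. r i)"
    by (subst det_upper_triangular[OF _ RC(1)])
      (auto simp: R_def diag_mat_def upper_triangular_def prod.list_conv_set_nth atLeast0LessThan)
  moreover have "Determinant.det C = (\<Prod>i<n. c i)"
    by (subst det_upper_triangular[OF _ RC(2)])
      (auto simp: C_def diag_mat_def upper_triangular_def prod.list_conv_set_nth atLeast0LessThan)
  ultimately show ?thesis
    using A RC by (simp add: det_mult[of _ n])
qed

text \<open>The cofactors along the last column of the Wronskian matrix once the powers of x are
  removed. The zeros in that column are placeholders, as the cofactor deletes it; hence the
  coefficients depend on \<open>\<nu>s\<close> alone.\<close>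

definition L_coeff :: "real list \<Rightarrow> nat \<Rightarrow> real" where
  "L_coeff \<nu>s i = cofactor (Matrix.mat (Suc (length \<nu>s)) (Suc (length \<nu>s))
     (\<lambda>(i, j). if j < length \<nu>s then \<Prod>l<i. \<nu>s ! j - real l else 0)) i (length \<nu>s)"

lemma L_quotient_eq:
  assumes h: "\<And>k x. x > 0 \<Longrightarrow> (h k has_real_derivative h (Suc k) x) (at x)"
    and f: "\<And>x. x > 0 \<Longrightarrow> f x = h 0 x" and "x > 0"
  shows "L_quotient \<nu>s f x = (\<Sum>i\<le>length \<nu>s. L_coeff \<nu>s i * (x ^ i * h i x))"
proof -
  define n where "n = length \<nu>s"
  define A where "A = Matrix.mat (Suc n) (Suc n)
    (\<lambda>(i, j). if j < n then \<Prod>l<i. \<nu>s ! j - real l else x ^ i * h i x)"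
  \<comment> \<open>In row i the power x^\<nu> contributes a falling factorial times x^(-i) x^\<nu>,
    which gives the row factor \<open>r\<close> and the column factor \<open>c\<close>. The last
    column has column factor 1, and its entries x^i h_i restore what the row factor takes
    away.\<close>
  define r where "r i = x powr (- real i)" for i :: nat
  define c where "c j = (if j < n then x powr (\<nu>s ! j) else 1)" for j
  have A: "A \<in> carrier_mat (Suc n) (Suc n)" by (simp add: A_def)
  have "wronskian (map (\<lambda>\<nu> t. t powr \<nu>) \<nu>s @ [f]) x =
      Determinant.det (Matrix.mat (Suc n) (Suc n) (\<lambda>(i, j). r i * A $$ (i, j) * c j))"
    unfolding wronskian_def
  proof (rule arg_cong[where f = Determinant.det], rule eq_matI, goal_cases)
    case (1 i j)
    show ?case
    proof (cases "j < n")
      case True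
      have "x powr (\<nu>s ! j - real i) = r i * x powr (\<nu>s ! j)"
        by (simp add: r_def powr_diff powr_minus divide_simps)
      with True 1 \<open>x > 0\<close> show ?thesis
        by (simp add: n_def nth_append funpow_deriv_powr A_def c_def)
    next
      case False
      then have "j = n" using 1 by simp
      have "x ^ i * x powr (- real i) = 1"
        using \<open>x > 0\<close> by (simp add: powr_minus powr_realpow)
      then have "(deriv ^^ i) f x = r i * (x ^ i * h i x)"
        using funpow_deriv_on_pos[of h f x i] h f \<open>x > 0\<close>
        by (simp add: r_def mult.commute)
      then show ?thesis using 1 \<open>j = n\<close>
        by (simp add: n_def nth_append A_def c_def)
    qed
  qed (auto simp: n_def)
  also have "\<dots> = (\<Prod>i<Suc n. r i) * (\<Prod>j<Suc n. c j) * Determinant.det A"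
    by (rule det_scale_rows_cols[OF A])
  also have "(\<Prod>i<Suc n. r i) = x powr (- (\<Sum>i<Suc n. real i))"
    using \<open>x > 0\<close> unfolding r_def
    by (subst powr_sum[symmetric]) (simp_all add: sum_negf del: sum.lessThan_Suc)
  also have "(\<Prod>j<Suc n. c j) = x powr (\<Sum>j<n. \<nu>s ! j)"
    using \<open>x > 0\<close> by (simp add: c_def powr_sum)
  \<comment> \<open>Rows 0 to n contribute the exponent -(0 + ... + n), and the shifts in the
    denominator of the quotient add up to 1 + ... + n. The two agree, so every power of x
    cancels.\<close>
  also have "x powr (- (\<Sum>i<Suc n. real i)) * x powr (\<Sum>j<n. \<nu>s ! j) = x powr (\<Sum>i<n. \<nu>s ! i - real (Suc i))"
    by (subst powr_add[symmetric], subst sum.lessThan_Suc_shift) (simp add: sum_subtractf o_def)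
  finally have "L_quotient \<nu>s f x = Determinant.det A"
    using \<open>x > 0\<close> by (simp add: L_quotient_def n_def)
  also have "\<dots> = (\<Sum>i<Suc n. A $$ (i, n) * cofactor A i n)"
    by (rule laplace_expansion_column[OF A]) simp
  also have "\<dots> = (\<Sum>i<Suc n. L_coeff \<nu>s i * (x ^ i * h i x))"
  proof (rule sum.cong[OF refl])
    fix i assume i: "i \<in> {..<Suc n}"
    have "mat_delete A i n = mat_delete (Matrix.mat (Suc n) (Suc n)
       (\<lambda>(i, j). if j < n then \<Prod>l<i. \<nu>s ! j - real l else 0)) i n"
      by (rule eq_matI) (auto simp: mat_delete_def A_def)
    then have "cofactor A i n = L_coeff \<nu>s i"
      by (simp add: cofactor_def L_coeff_def n_def)
    then show "A $$ (i, n) * cofactor A i n = L_coeff \<nu>s i * (x ^ i * h i x)"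
      using i by (simp add: A_def)
  qed
  finally show ?thesis by (simp add: n_def lessThan_Suc_atMost)
qed

text \<open>For x > 0 this is the formula for the quotient. At 0 the operator is a limit from the
  right, and the Euler sum is continuous up to 0, so the limit is its value there.\<close>

lemma L_op_eq:
  assumes h: "half_line_derivs h" and f: "\<And>x. x \<ge> 0 \<Longrightarrow> f x = h 0 x"
    and "\<nu>s \<noteq> []" "x \<ge> 0"
  shows "L_op \<nu>s f x = (\<Sum>i\<le>length \<nu>s. L_coeff \<nu>s i * (x ^ i * h i x))" (is "_ = ?R x")
proof -
  have pos: "L_quotient \<nu>s f x = ?R x" if "x > 0" for x
    by (rule L_quotient_eq) (use h f that half_line_derivs_at in auto)
  have "continuous_on {0..} ?R"
    by (intro continuous_intros half_line_derivs_continuous[OF h])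
  then have "(?R \<longlongrightarrow> ?R 0) (at 0 within {0..})"
    unfolding continuous_on_def by auto
  then have "(?R \<longlongrightarrow> ?R 0) (at_right 0)"
    by (rule tendsto_within_subset) auto
  moreover have "\<forall>\<^sub>F x in at_right 0. ?R x = L_quotient \<nu>s f x"
    using pos by (auto simp: eventually_at_right_less intro!: eventually_mono[OF eventually_at_right_less])
  ultimately have "(L_quotient \<nu>s f \<longlongrightarrow> ?R 0) (at_right 0)"
    by (rule Lim_transform_eventually)
  then have "Lim (at_right 0) (L_quotient \<nu>s f) = ?R 0"
    by (intro tendsto_Lim) auto
  then show ?thesis using pos[of x] assms by (auto simp: L_op_def)
qed

lemma L_op_F_op:
  assumes "analytic_half_line f" "x \<ge> 0"
  shows "L_op \<nu>s (F_op f) x = F_op (L_op \<nu>s f) x"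
proof (cases "\<nu>s = []")
  case False
  obtain h where h: "h 0 = f" "half_line_derivs h"
    using analytic_half_line_derivs assms(1) by blast
  have "F_op (L_op \<nu>s f) x =
      integral {0..pi/2} (\<lambda>\<theta>. \<Sum>i\<le>length \<nu>s. L_coeff \<nu>s i * (x ^ i * (sin \<theta> ^ i * h i (x * sin \<theta>))))"
    unfolding F_op_def
    by (intro integral_cong, subst L_op_eq[OF h(2)])
      (use assms sin_nonneg_quarter False in \<open>auto simp: h(1) power_mult_distrib mult_ac\<close>)
  also have "\<dots> = (\<Sum>i\<le>length \<nu>s. L_coeff \<nu>s i * (x ^ i * F_deriv h i x))"
    unfolding F_deriv_def
    by (subst integral_sum)
      (auto intro!: integrable_continuous_real continuous_intros mult_nonneg_nonneg sin_nonneg_quarter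
          continuous_on_compose2[OF half_line_derivs_continuous[OF h(2)]] assms)
  also have "\<dots> = L_op \<nu>s (F_op f) x"
    by (rule L_op_eq[OF half_line_derivs_F_deriv[OF h(2)], symmetric])
      (use assms False in \<open>auto simp: F_deriv_def F_op_def h(1)\<close>)
  finally show ?thesis by simp
qed (simp add: L_op_def)

section \<open>Expansion of the integral operator\<close>

text \<open>The coefficient of t^k in (1 - t)^(-1/2), which is binomial(2k, k) / 4^k. The product
  form allows a factor-by-factor comparison with \<open>b_coeff\<close>.\<close>

definition central_coeff :: "nat \<Rightarrow> real" where
  "central_coeff k = (\<Prod>i=1..k. (2 * real i - 1) / (2 * real i))"

lemma central_coeff_0 [simp]: "central_coeff 0 = 1"
  by (simp add: central_coeff_def)

lemma central_coeff_Suc: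
  "central_coeff (Suc k) = central_coeff k * ((2 * real k + 1) / (2 * real k + 2))"
  by (simp add: central_coeff_def add.commute)

text \<open>Reversing the product replaces i by m + 1 - i. At \<alpha> = -1 - 2m the numerator is
  then -(2i - 1) and the denominator -2i, and the signs cancel.\<close>

lemma b_coeff_eq_central_coeff:
  assumes "\<alpha> + 2 * real m = -1"
  shows "b_coeff m \<alpha> = central_coeff m"
proof -
  have "b_coeff m \<alpha> = (\<Prod>i=1..m. (\<alpha> + 2 * real (m + 1 - i)) / (\<alpha> + 2 * real (m + 1 - i) - 1))"
    unfolding b_coeff_def by (subst prod.atLeastAtMost_rev) (simp add: add.commute)
  also have "\<dots> = central_coeff m"
    unfolding central_coeff_def
  proof (rule prod.cong[OF refl])
    fix i assume i: "i \<in> {1..m}"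
    then have *: "\<alpha> + 2 * real (m + 1 - i) = - (2 * real i - 1)"
      using assms by (simp add: of_nat_diff)
    show "(\<alpha> + 2 * real (m + 1 - i)) / (\<alpha> + 2 * real (m + 1 - i) - 1) = (2 * real i - 1) / (2 * real i)"
      using i unfolding * by (simp add: divide_simps)
  qed
  finally show ?thesis .
qed

lemma central_coeff_pos: "central_coeff k > 0"
  by (induction k) (auto simp: central_coeff_Suc)

lemma central_coeff_antimono: "central_coeff (k + j) \<le> central_coeff k"
proof (induction j)
  case (Suc j)
  have "central_coeff (Suc (k + j)) \<le> central_coeff (k + j) * 1"
    unfolding central_coeff_Suc
    by (intro mult_left_mono less_imp_le[OF central_coeff_pos]) simp
  with Suc show ?case by simp
qed simp

lemma central_coeff_gchoose: "central_coeff k = (-1) ^ k * ((-1/2) gchoose k)"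
proof (induction k)
  case (Suc k)
  have "((-1/2) gchoose Suc k) * real (Suc k) = (-1/2 - real k) * ((-1/2) gchoose k)"
    using gbinomial_mult_1[of "-1/2::real" k] by (simp add: algebra_simps)
  then have "((-1/2) gchoose Suc k) = (-1/2 - real k) * ((-1/2) gchoose k) / real (Suc k)"
    by (simp add: field_simps)
  note eq = this
  show ?case unfolding central_coeff_Suc Suc eq by (simp add: field_simps)
qed simp

lemma central_coeff_sums:
  assumes "0 \<le> t" "t < 1"
  shows "(\<lambda>k. central_coeff k * t ^ k) sums (1 / sqrt (1 - t))"
proof -
  have "(\<lambda>k. ((-1/2) gchoose k) * (- t) ^ k) sums (1 - t) powr (-1/2)"
    using gen_binomial_real[of "- t" "-1/2"] assms by simp
  moreover have "((-1/2) gchoose k) * (- t) ^ k = central_coeff k * t ^ k" for k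
    unfolding central_coeff_gchoose power_minus[of t] by simp
  moreover have "(1 - t) powr (-1/2) = 1 / sqrt (1 - t)"
    using assms powr_minus_divide[of "1 - t" "1/2"] by (simp add: powr_half_sqrt)
  ultimately show ?thesis by simp
qed

text \<open>The coefficients are positive and decreasing, so the tail of the series from t^(m+1) on
  lies between 0 and t^(m+1) times the full sum (1 - t)^(-1/2). Multiplication by sqrt(1 - t)
  cancels the full sum and leaves a bound uniform up to t = 1. At t = 1 itself the root vanishes and
  both sides are 1.\<close>

lemma inverse_sqrt_remainder:
  assumes "0 \<le> t" "t \<le> 1"
  shows "\<bar>1 - sqrt (1 - t) * (\<Sum>k\<le>m. central_coeff k * t ^ k)\<bar> \<le> t ^ Suc m"
proof (cases "t = 1")
  case False
  define S where "S = 1 / sqrt (1 - t)"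
  have q: "sqrt (1 - t) > 0" using False assms by simp
  have sums: "(\<lambda>k. central_coeff k * t ^ k) sums S"
    unfolding S_def by (rule central_coeff_sums) (use False assms in auto)
  define R where "R = S - (\<Sum>k\<le>m. central_coeff k * t ^ k)"
  have R: "(\<lambda>k. central_coeff (k + Suc m) * t ^ (k + Suc m)) sums R"
    unfolding R_def using sums_split_initial_segment[OF sums, of "Suc m"]
    by (simp only: lessThan_Suc_atMost)
  have "R \<ge> 0"
    by (rule sums_le[OF _ sums_zero R]) (intro mult_nonneg_nonneg zero_le_power less_imp_le[OF central_coeff_pos] assms)
  moreover have "R \<le> t ^ Suc m * S"
  proof (rule sums_le[OF _ R sums_mult[OF sums]])
    fix k
    have "central_coeff (k + Suc m) * t ^ (k + Suc m) \<le> central_coeff k * t ^ (k + Suc m)"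
      using assms by (intro mult_right_mono central_coeff_antimono) auto
    then show "central_coeff (k + Suc m) * t ^ (k + Suc m) \<le> t ^ Suc m * (central_coeff k * t ^ k)"
      by (simp add: power_add mult_ac)
  qed
  moreover have "1 - sqrt (1 - t) * (\<Sum>k\<le>m. central_coeff k * t ^ k) = sqrt (1 - t) * R"
    using q by (simp add: R_def S_def algebra_simps)
  moreover have "sqrt (1 - t) * (t ^ Suc m * S) = t ^ Suc m"
    using q by (simp add: S_def)
  moreover have "sqrt (1 - t) * R \<le> sqrt (1 - t) * (t ^ Suc m * S)"
    using q \<open>R \<le> t ^ Suc m * S\<close> by (intro mult_left_mono) auto
  moreover have "0 \<le> sqrt (1 - t) * R" using q \<open>R \<ge> 0\<close> by simp
  ultimately show ?thesis by linarith
qed simp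

text \<open>In the angular variable the factor \<open>cos \<theta>\<close> absorbs the singularity of $(1-u^2)^{-1/2}$ at
  \<open>u = 1\<close>, so no improper integrals occur.\<close>

lemma F_op_expansion:
  assumes g: "continuous_on {0..} g" and "x > 0"
    and B: "\<And>s. s \<in> {0..x} \<Longrightarrow> s ^ (2 * Suc m) * \<bar>g s\<bar> \<le> B"
  shows "\<bar>x ^ (2*m+1) * F_op g x -
    (\<Sum>k\<le>m. central_coeff k * (x ^ (2*(m-k)) * integral {0..x} (\<lambda>s. s ^ (2*k) * g s)))\<bar> \<le> pi / 2 * B / x"
proof -
  have cg: "continuous_on {0..pi/2} (\<lambda>\<theta>. g (x * sin \<theta>))"
    by (intro continuous_on_compose2[OF g] continuous_intros)
      (use \<open>x > 0\<close> in \<open>auto intro!: mult_nonneg_nonneg sin_nonneg_quarter\<close>)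
  \<comment> \<open>With t = (sin \<theta>)^2 the root sqrt(1 - t) is cos \<theta>, which is
    nonnegative here, so E is the remainder just estimated.\<close>
  define E where "E \<theta> = 1 - cos \<theta> * (\<Sum>k\<le>m. central_coeff k * sin \<theta> ^ (2*k))" for \<theta>
  have E: "\<bar>E \<theta>\<bar> \<le> sin \<theta> ^ (2 * Suc m)" if "\<theta> \<in> {0..pi/2}" for \<theta>
  proof -
    have "cos \<theta> \<ge> 0" using that by (intro cos_ge_zero) auto
    then have "sqrt (1 - (sin \<theta>)\<^sup>2) = cos \<theta>"
      by (simp add: cos_squared_eq[symmetric])
    then show ?thesis
      using inverse_sqrt_remainder[of "(sin \<theta>)\<^sup>2" m] abs_square_le_1[of "sin \<theta>"]
      unfolding E_def power_mult by (simp del: power_Suc)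
  qed
  \<comment> \<open>Substituting s = x sin \<theta> produces x^(2k) from the integrand and x cos
    \<theta> from ds; the prefactor completes x^(2k+1) to x^(2m+1), the same power for every
    k.\<close>
  have moment: "x ^ (2*(m-k)) * integral {0..x} (\<lambda>s. s ^ (2*k) * g s) =
      x ^ (2*m+1) * integral {0..pi/2} (\<lambda>\<theta>. cos \<theta> * sin \<theta> ^ (2*k) * g (x * sin \<theta>))"
    if "k \<le> m" for k
  proof -
    have "((\<lambda>\<theta>. (x * cos \<theta>) *\<^sub>R ((x * sin \<theta>) ^ (2*k) * g (x * sin \<theta>))) has_integral
        integral {x * sin 0..x * sin (pi/2)} (\<lambda>s. s ^ (2*k) * g s)) {0..pi/2}"
    proof (rule has_integral_substitution[where c = 0 and d = x])
      show "(\<lambda>\<theta>. x * sin \<theta>) ` {0..pi/2} \<subseteq> {0..x}"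
        using \<open>x > 0\<close> by (auto simp: mult_le_cancel_left1 intro!: mult_nonneg_nonneg sin_nonneg_quarter)
      show "continuous_on {0..x} (\<lambda>s. s ^ (2*k) * g s)"
        by (intro continuous_intros continuous_on_subset[OF g]) auto
      show "((\<lambda>\<theta>. x * sin \<theta>) has_real_derivative x * cos \<theta>) (at \<theta> within {0..pi/2})" for \<theta>
        by (auto intro!: derivative_eq_intros)
    qed (use \<open>x > 0\<close> in auto)
    then have "integral {0..x} (\<lambda>s. s ^ (2*k) * g s) =
        integral {0..pi/2} (\<lambda>\<theta>. x ^ (2*k+1) * (cos \<theta> * sin \<theta> ^ (2*k) * g (x * sin \<theta>)))"
      by (simp add: has_integral_iff power_mult_distrib mult_ac)
    also have "\<dots> = x ^ (2*k+1) * integral {0..pi/2} (\<lambda>\<theta>. cos \<theta> * sin \<theta> ^ (2*k) * g (x * sin \<theta>))"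
      by (rule integral_mult_right)
    finally have "x ^ (2*(m-k)) * integral {0..x} (\<lambda>s. s ^ (2*k) * g s) =
        x ^ (2*(m-k) + (2*k+1)) * integral {0..pi/2} (\<lambda>\<theta>. cos \<theta> * sin \<theta> ^ (2*k) * g (x * sin \<theta>))"
      by (simp only: power_add mult.assoc)
    also have "2*(m-k) + (2*k+1) = 2*m+1" using that by simp
    finally show ?thesis .
  qed
  have "(\<Sum>k\<le>m. central_coeff k * (x ^ (2*(m-k)) * integral {0..x} (\<lambda>s. s ^ (2*k) * g s))) =
      x ^ (2*m+1) * (\<Sum>k\<le>m. integral {0..pi/2} (\<lambda>\<theta>. central_coeff k * (cos \<theta> * sin \<theta> ^ (2*k) * g (x * sin \<theta>))))"
    unfolding sum_distrib_left
  proof (intro sum.cong refl)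
    fix k assume "k \<in> {..m}"
    then have "k \<le> m" by simp
    have swap: "c * L = P * I'" if "I' = c * I" "L = P * I" for c L P I I' :: real
      using that by simp
    show "central_coeff k * (x ^ (2*(m-k)) * integral {0..x} (\<lambda>s. s ^ (2*k) * g s)) =
        x ^ (2*m+1) * integral {0..pi/2} (\<lambda>\<theta>. central_coeff k * (cos \<theta> * sin \<theta> ^ (2*k) * g (x * sin \<theta>)))"
      by (rule swap[OF integral_mult_right moment[OF \<open>k \<le> m\<close>]])
  qed
  also have "(\<Sum>k\<le>m. integral {0..pi/2} (\<lambda>\<theta>. central_coeff k * (cos \<theta> * sin \<theta> ^ (2*k) * g (x * sin \<theta>)))) =
      integral {0..pi/2} (\<lambda>\<theta>. \<Sum>k\<le>m. central_coeff k * (cos \<theta> * sin \<theta> ^ (2*k) * g (x * sin \<theta>)))"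
    by (subst integral_sum) (auto intro!: integrable_continuous_real continuous_intros cg)
  finally have "x ^ (2*m+1) * F_op g x -
      (\<Sum>k\<le>m. central_coeff k * (x ^ (2*(m-k)) * integral {0..x} (\<lambda>s. s ^ (2*k) * g s))) =
      x ^ (2*m+1) * F_op g x - x ^ (2*m+1) *
        integral {0..pi/2} (\<lambda>\<theta>. \<Sum>k\<le>m. central_coeff k * (cos \<theta> * sin \<theta> ^ (2*k) * g (x * sin \<theta>)))"
    by (rule arg_cong)
  also have "\<dots> = x ^ (2*m+1) * (integral {0..pi/2} (\<lambda>\<theta>. g (x * sin \<theta>)) -
        integral {0..pi/2} (\<lambda>\<theta>. \<Sum>k\<le>m. central_coeff k * (cos \<theta> * sin \<theta> ^ (2*k) * g (x * sin \<theta>))))"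
    by (simp add: F_op_def right_diff_distrib)
  also have "\<dots> = x ^ (2*m+1) * integral {0..pi/2} (\<lambda>\<theta>. g (x * sin \<theta>) -
        (\<Sum>k\<le>m. central_coeff k * (cos \<theta> * sin \<theta> ^ (2*k) * g (x * sin \<theta>))))"
    by (subst integral_diff) (auto intro!: integrable_continuous_real continuous_intros cg)
  also have "\<dots> = x ^ (2*m+1) * integral {0..pi/2} (\<lambda>\<theta>. g (x * sin \<theta>) * E \<theta>)"
    by (intro arg_cong2[where f = "(*)"] integral_cong refl)
      (simp add: E_def right_diff_distrib sum_distrib_left mult_ac)
  also have "\<dots> = integral {0..pi/2} (\<lambda>\<theta>. x ^ (2*m+1) * (g (x * sin \<theta>) * E \<theta>))"
    by (rule integral_mult_right[symmetric])
  finally have "\<bar>x ^ (2*m+1) * F_op g x -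
      (\<Sum>k\<le>m. central_coeff k * (x ^ (2*(m-k)) * integral {0..x} (\<lambda>s. s ^ (2*k) * g s)))\<bar> =
      \<bar>integral {0..pi/2} (\<lambda>\<theta>. x ^ (2*m+1) * (g (x * sin \<theta>) * E \<theta>))\<bar>"
    by (rule arg_cong[where f = abs])
  also have "\<dots> \<le> integral {0..pi/2} (\<lambda>\<theta>. B / x)"
    unfolding real_norm_def[symmetric]
  proof (rule integral_norm_bound_integral)
    show "(\<lambda>\<theta>. x ^ (2*m+1) * (g (x * sin \<theta>) * E \<theta>)) integrable_on {0..pi/2}"
      unfolding E_def by (intro integrable_continuous_real continuous_intros cg)
    fix \<theta> assume \<theta>: "\<theta> \<in> {0..pi/2}"
    have s: "x * sin \<theta> \<in> {0..x}"
      using \<open>x > 0\<close> sin_nonneg_quarter[OF \<theta>] by (auto simp: mult_le_cancel_left1)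
    have "norm (x ^ (2*m+1) * (g (x * sin \<theta>) * E \<theta>)) = x ^ (2*m+1) * \<bar>g (x * sin \<theta>)\<bar> * \<bar>E \<theta>\<bar>"
      using \<open>x > 0\<close> by (simp add: abs_mult)
    also have "\<dots> \<le> x ^ (2*m+1) * \<bar>g (x * sin \<theta>)\<bar> * sin \<theta> ^ (2 * Suc m)"
      using \<open>x > 0\<close> by (intro mult_left_mono E[OF \<theta>]) auto
    \<comment> \<open>The power x^(2m+1) is one short of the x^(2m+2) needed to form (x sin
      \<theta>)^(2m+2); this is the source of the factor 1/x in the error.\<close>
    also have "\<dots> = ((x * sin \<theta>) ^ (2 * Suc m) * \<bar>g (x * sin \<theta>)\<bar>) / x"
      using \<open>x > 0\<close> by (simp add: power_mult_distrib field_simps)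
    also have "\<dots> \<le> B / x"
      using \<open>x > 0\<close> by (intro divide_right_mono B[OF s]) auto
    finally show "norm (x ^ (2*m+1) * (g (x * sin \<theta>) * E \<theta>)) \<le> B / x" .
  qed auto
  also have "\<dots> = pi / 2 * B / x" by simp
  finally show ?thesis .
qed

section \<open>Tails of vanishing moments\<close>

text \<open>As the full integral vanishes, the integral up to x is minus the tail beyond x, which is
  dominated by the integral of C s^(\<alpha>+j). The tail is cut at a large y, where the integral
  from 0 is within e of 0.\<close>

lemma integral_zero_tail_bound:
  fixes g :: "real \<Rightarrow> real"
  assumes g: "continuous_on {0..} g"
    and int: "(\<lambda>s. s ^ j * g s) integrable_on {0..}" "integral {0..} (\<lambda>s. s ^ j * g s) = 0"
    and "x > 0" and bound: "\<And>s. s \<ge> x \<Longrightarrow> \<bar>g s\<bar> \<le> C * s powr \<alpha>" and p: "\<alpha> + real j + 1 < 0"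
  shows "\<bar>integral {0..x} (\<lambda>s. s ^ j * g s)\<bar> \<le> C * x powr (\<alpha> + real j + 1) / (- (\<alpha> + real j + 1))"
proof (rule field_le_epsilon)
  fix e :: real assume "e > 0"
  define \<phi> where "\<phi> = (\<lambda>s. s ^ j * g s)"
  define p where "p = \<alpha> + real j + 1"
  have \<phi>: "continuous_on {0..} \<phi>" unfolding \<phi>_def by (intro continuous_intros g)
  have "(\<phi> has_integral 0) {0..}"
    using int by (simp add: \<phi>_def has_integral_iff)
  then obtain R where "R > 0" and R: "\<And>a b. ball 0 R \<subseteq> cbox a b \<Longrightarrow>
      norm (integral (cbox a b) (\<lambda>x. if x \<in> {0..} then \<phi> x else 0) - 0) < e"
    unfolding has_integral_alt'[of \<phi>] using \<open>e > 0\<close> by blast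
  \<comment> \<open>With y at least R, the interval [-y, y] contains the ball from the gauge
    definition of the integral; its negative half contributes nothing, as the integrand is set to 0
    there.\<close>
  define y where "y = max R x"
  have y: "y \<ge> x" "y \<ge> R" "y > 0" using \<open>x > 0\<close> by (auto simp: y_def)
  have "\<bar>integral {- y..y} (\<lambda>x. if x \<in> {0..} then \<phi> x else 0)\<bar> < e"
  proof -
    have "ball 0 R \<subseteq> cbox (- y) y" using y by (auto simp: dist_real_def)
    from R[OF this] show ?thesis by simp
  qed
  also have "integral {- y..y} (\<lambda>x. if x \<in> {0..} then \<phi> x else 0) = integral ({0..} \<inter> {- y..y}) \<phi>"
    by (rule Henstock_Kurzweil_Integration.integral_restrict_Int)
  also have "{0..} \<inter> {- y..y} = {0..y}" using y by auto
  finally have 1: "\<bar>integral {0..y} \<phi>\<bar> < e" .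
  have 2: "integral {0..x} \<phi> + integral {x..y} \<phi> = integral {0..y} \<phi>"
    using y \<open>x > 0\<close>
    by (intro Henstock_Kurzweil_Integration.integral_combine integrable_continuous_real
        continuous_on_subset[OF \<phi>]) auto
  have dom: "((\<lambda>s. C * s powr (\<alpha> + real j)) has_integral (C * y powr p / p - C * x powr p / p)) {x..y}"
  proof (rule fundamental_theorem_of_calculus)
    fix s assume "s \<in> {x..y}"
    then show "((\<lambda>s. C * s powr p / p) has_vector_derivative C * s powr (\<alpha> + real j)) (at s within {x..y})"
      unfolding has_real_derivative_iff_has_vector_derivative[symmetric]
      using \<open>x > 0\<close> p by (auto intro!: derivative_eq_intros simp: p_def)
  qed (use y in auto)
  have "norm (integral {x..y} \<phi>) \<le> integral {x..y} (\<lambda>s. C * s powr (\<alpha> + real j))"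
  proof (rule integral_norm_bound_integral)
    show "\<phi> integrable_on {x..y}"
      by (intro integrable_continuous_real continuous_on_subset[OF \<phi>]) (use \<open>x > 0\<close> in auto)
    fix s assume s: "s \<in> {x..y}"
    then have "s > 0" using \<open>x > 0\<close> by simp
    have "norm (\<phi> s) = s ^ j * \<bar>g s\<bar>" using \<open>s > 0\<close> by (simp add: \<phi>_def abs_mult)
    also have "\<dots> \<le> s ^ j * (C * s powr \<alpha>)"
      using \<open>s > 0\<close> s bound by (intro mult_left_mono) auto
    also have "\<dots> = C * s powr (\<alpha> + real j)"
      using \<open>s > 0\<close> by (simp add: powr_add powr_realpow)
    finally show "norm (\<phi> s) \<le> C * s powr (\<alpha> + real j)" .
  qed (use dom in auto)
  also have "\<dots> = C * y powr p / p - C * x powr p / p"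
    using dom by (rule integral_unique)
  also have "\<dots> \<le> C * x powr p / (- p)"
  proof -
    have "C * x powr \<alpha> \<ge> 0" using bound[of x] by auto
    then have "C \<ge> 0" using \<open>x > 0\<close> by (simp add: zero_le_mult_iff)
    then have "C * y powr p / p \<le> 0"
      using p by (auto simp: p_def divide_le_0_iff)
    then show ?thesis by simp
  qed
  finally show "\<bar>integral {0..x} (\<lambda>s. s ^ j * g s)\<bar> \<le>
     C * x powr (\<alpha> + real j + 1) / (- (\<alpha> + real j + 1)) + e"
    using 1 2 unfolding \<phi>_def[symmetric] p_def[symmetric] real_norm_def by linarith
qed

section \<open>The compensator and the factor in \<open>Omega\<close>\<close>

text \<open>With the compensator seen as the primitive of s^\<beta> that vanishes at 1, estimates
  follow from comparing integrands, without treating \<beta> = -1 separately.\<close>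

lemma has_integral_compensator:
  assumes "x \<ge> 1"
  shows "((\<lambda>s. s powr \<beta>) has_integral compensator x \<beta>) {1..x}"
proof (cases "\<beta> = -1")
  case True
  have "((\<lambda>s. s powr \<beta>) has_integral (ln x - ln 1)) {1..x}"
  proof (rule fundamental_theorem_of_calculus)
    fix s assume "s \<in> {1..x}"
    then show "(ln has_vector_derivative s powr \<beta>) (at s within {1..x})"
      unfolding has_real_derivative_iff_has_vector_derivative[symmetric]
      by (auto intro!: derivative_eq_intros simp: True powr_minus field_simps)
  qed (use assms in auto)
  then show ?thesis by (simp add: compensator_def True)
next
  case False
  have "((\<lambda>s. s powr \<beta>) has_integral (x powr (\<beta> + 1) / (\<beta> + 1) - 1 powr (\<beta> + 1) / (\<beta> + 1))) {1..x}"
  proof (rule fundamental_theorem_of_calculus)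
    fix s assume "s \<in> {1..x}"
    then show "((\<lambda>s. s powr (\<beta> + 1) / (\<beta> + 1)) has_vector_derivative s powr \<beta>) (at s within {1..x})"
      unfolding has_real_derivative_iff_has_vector_derivative[symmetric]
      using False by (auto intro!: derivative_eq_intros)
  qed (use assms in auto)
  then show ?thesis using False by (simp add: compensator_def diff_divide_distrib)
qed

lemma powr_eq_compensator: "x > 0 \<Longrightarrow> x powr (\<beta> + 1) = 1 + (\<beta> + 1) * compensator x \<beta>"
  by (simp add: compensator_def)

text \<open>For s between 1 and X, s^(1 / ln X) is at most X^(1 / ln X) = e, so s^\<beta> is at
  least s^(-1) / e. Integration up to X gives the bound, and the positive integrand carries it to
  larger x. Exponents slightly below -1, where the compensator stays bounded in x, are thus
  included.\<close>

lemma compensator_lower_bound: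
  assumes "X > 1" "x \<ge> X" "\<beta> \<ge> -1 - 1 / ln X"
  shows "ln X / exp 1 \<le> compensator x \<beta>"
proof -
  have "ln X > 0" using assms by simp
  have "ln X / exp 1 \<le> compensator X \<beta>"
  proof (rule has_integral_le)
    show "((\<lambda>s. s powr (-1) / exp 1) has_integral ln X / exp 1) {1..X}"
      using has_integral_divide[OF has_integral_compensator[of X "-1"]] assms
      by (simp add: compensator_def)
    show "((\<lambda>s. s powr \<beta>) has_integral compensator X \<beta>) {1..X}"
      by (rule has_integral_compensator) (use assms in auto)
    fix s assume s: "s \<in> {1..X}"
    have "ln s / ln X \<le> 1" using s assms by simp
    have "s powr (-1) / exp 1 = exp (- ln s - 1)"
      using s by (simp add: powr_def exp_diff)
    also have "\<dots> \<le> exp (- ln s - ln s / ln X)"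
      using \<open>ln s / ln X \<le> 1\<close> by simp
    also have "\<dots> = s powr (-1 - 1 / ln X)"
      using s by (simp add: powr_def algebra_simps)
    also have "\<dots> \<le> s powr \<beta>"
      using s assms by (intro powr_mono) auto
    finally show "s powr (-1) / exp 1 \<le> s powr \<beta>" .
  qed
  also have "\<dots> \<le> compensator x \<beta>"
    by (rule has_integral_subset_le[OF _ has_integral_compensator has_integral_compensator])
      (use assms in auto)
  finally show ?thesis .
qed

lemma filterlim_compensator:
  "filterlim (\<lambda>(x, \<beta>). compensator x \<beta>) at_top (at_top \<times>\<^sub>F nhds (-1))"
  unfolding filterlim_at_top
proof
  fix Z :: real
  \<comment> \<open>The lower bound is used with X = exp Y, so that ln X = Y and Y / e is at least
    Z; the admissible exponents are those above -1 - 1/Y.\<close>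
  define Y where "Y = max 1 (Z * exp 1)"
  have Y: "Y > 0" "Z \<le> Y / exp 1" by (auto simp: Y_def field_simps)
  have "\<forall>\<^sub>F \<beta> in nhds (-1). \<beta> > -1 - 1 / Y"
    by (rule eventually_nhds_in_open[of "{-1 - 1 / Y<..}", simplified]) (use Y in auto)
  from eventually_prodI[OF eventually_ge_at_top[of "exp Y"] this] show "\<forall>\<^sub>F p in at_top \<times>\<^sub>F nhds (-1). Z \<le> (case p of (x, \<beta>) \<Rightarrow> compensator x \<beta>)"
  proof eventually_elim
    case (elim p)
    then have "ln (exp Y) / exp 1 \<le> compensator (fst p) (snd p)"
      using Y by (intro compensator_lower_bound) auto
    then show ?case using Y by (simp add: case_prod_unfold)
  qed
qed

text \<open>The functional equation of Gamma absorbs the factor \<beta> + 1 and turns the expression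
  into sqrt(pi) Gamma((3+\<beta>)/2) / Gamma(1+\<beta>/2), which is continuous at -1 with value 1
  because Gamma(1/2) = sqrt(pi).\<close>

lemma Omega_factor_tendsto:
  "((\<lambda>\<beta>. if \<beta> = -1 then 1 else (\<beta> + 1) * G_fun \<beta>) \<longlongrightarrow> 1) (nhds (-1))"
proof -
  have "((\<lambda>\<beta>::real. sqrt pi * (Gamma ((3 + \<beta>) / 2) / Gamma (1 + \<beta> / 2))) \<longlongrightarrow>
      sqrt pi * (Gamma ((3 + (-1)) / 2) / Gamma (1 + (-1) / 2))) (nhds (-1))"
    by (intro tendsto_intros filterlim_ident) (auto simp: Gamma_eq_zero_iff elim!: nonpos_Ints_cases)
  also have "sqrt pi * (Gamma ((3 + (-1)) / 2) / Gamma (1 + (-1) / 2)) = (1::real)"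
    by (simp add: Gamma_one_half_real)
  finally show ?thesis
  proof (rule Lim_transform_eventually)
    have "\<forall>\<^sub>F \<beta> in nhds (-1::real). \<beta> > -2"
      by (rule eventually_nhds_in_open[of "{-2<..}", simplified]) auto
    then show "\<forall>\<^sub>F \<beta> in nhds (-1). sqrt pi * (Gamma ((3 + \<beta>) / 2) / Gamma (1 + \<beta> / 2)) =
        (if \<beta> = -1 then 1 else (\<beta> + 1) * G_fun \<beta>)"
    proof eventually_elim
      case (elim \<beta>)
      show ?case
      proof (cases "\<beta> = -1")
        case False
        \<comment> \<open>Since \<beta> > -2, the only pole this argument could meet is 0, that is
          \<beta> = -1.\<close>
        have "(1 + \<beta>) / 2 \<notin> \<int>\<^sub>\<le>\<^sub>0"
        proof
          assume "(1 + \<beta>) / 2 \<in> \<int>\<^sub>\<le>\<^sub>0"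
          then obtain n where n: "(1 + \<beta>) / 2 = of_int n" "n \<le> 0" by (elim nonpos_Ints_cases)
          then have "real_of_int n > -1" 
            using elim unfolding n(1)[symmetric] by simp
          then have "n = 0" using n(2) by linarith
          then show False using n False by simp
        qed
        then have "Gamma ((1 + \<beta>) / 2 + 1) = (1 + \<beta>) / 2 * Gamma ((1 + \<beta>) / 2)"
          by (rule Gamma_plus1)
        also have "(1 + \<beta>) / 2 + 1 = (3 + \<beta>) / 2" by (simp add: field_simps)
        finally have eq: "Gamma ((3 + \<beta>) / 2) = (1 + \<beta>) / 2 * Gamma ((1 + \<beta>) / 2)" .
        show ?thesis using False unfolding eq G_fun_def by (simp add: field_simps)
      qed (simp add: Gamma_one_half_real)
    qed
  qed
qed

section \<open>Uniform asymptotics\<close>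

text \<open>A set of the product filter contains a rectangle, so the threshold K can be chosen
  independently of \<mu>. The comparison is with the constant \<open>a \<mu>0\<close>.\<close>

lemma quantified_by_power_uniform:
  assumes "quantified_by_power g a \<alpha> \<mu>0" "e > 0"
  obtains K where "K \<ge> 1"
    "\<forall>\<^sub>F \<mu> in nhds \<mu>0. \<forall>s\<ge>K. \<bar>g \<mu> s * s powr (- \<alpha> \<mu>) - a \<mu>0\<bar> < e"
proof -
  have "((\<lambda>(x, \<mu>). g \<mu> x * x powr (- \<alpha> \<mu>)) \<longlongrightarrow> a \<mu>0) (at_top \<times>\<^sub>F nhds \<mu>0)"
    using assms by (simp add: quantified_by_power_def)
  then have "\<forall>\<^sub>F p in at_top \<times>\<^sub>F nhds \<mu>0. dist (case p of (x, \<mu>) \<Rightarrow> g \<mu> x * x powr (- \<alpha> \<mu>)) (a \<mu>0) < e"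
    using \<open>e > 0\<close> by (rule tendstoD)
  then obtain P Q where P: "eventually P at_top" and Q: "eventually Q (nhds \<mu>0)"
    and PQ: "\<And>x \<mu>. P x \<Longrightarrow> Q \<mu> \<Longrightarrow> \<bar>g \<mu> x * x powr (- \<alpha> \<mu>) - a \<mu>0\<bar> < e"
    unfolding eventually_prod_filter by (auto simp: dist_real_def)
  from P obtain N where N: "\<And>x. x \<ge> N \<Longrightarrow> P x"
    by (auto simp: eventually_at_top_linorder)
  show thesis
  proof (rule that[of "max 1 N"])
    show "\<forall>\<^sub>F \<mu> in nhds \<mu>0. \<forall>s\<ge>max 1 N. \<bar>g \<mu> s * s powr (- \<alpha> \<mu>) - a \<mu>0\<bar> < e"
      using Q by eventually_elim (use N PQ in auto)
  qed simp
qed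

lemma quantified_by_power_bound:
  assumes "quantified_by_power g a \<alpha> \<mu>0"
  obtains K C where "K \<ge> 1" "C \<ge> 0"
    "\<forall>\<^sub>F \<mu> in nhds \<mu>0. \<forall>s\<ge>K. \<bar>g \<mu> s\<bar> \<le> C * s powr \<alpha> \<mu>"
proof -
  obtain K where K: "K \<ge> 1"
    "\<forall>\<^sub>F \<mu> in nhds \<mu>0. \<forall>s\<ge>K. \<bar>g \<mu> s * s powr (- \<alpha> \<mu>) - a \<mu>0\<bar> < 1"
    using quantified_by_power_uniform[OF assms, of 1] by auto
  from K(2) have "\<forall>\<^sub>F \<mu> in nhds \<mu>0. \<forall>s\<ge>K. \<bar>g \<mu> s\<bar> \<le> (\<bar>a \<mu>0\<bar> + 1) * s powr \<alpha> \<mu>"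
  proof eventually_elim
    case (elim \<mu>)
    show ?case
    proof (intro allI impI)
      fix s assume s: "s \<ge> K"
      then have "s > 0" using K by simp
      have "\<bar>g \<mu> s * s powr (- \<alpha> \<mu>)\<bar> \<le> \<bar>a \<mu>0\<bar> + 1"
        using elim s by (smt (verit))
      then have "\<bar>g \<mu> s * s powr (- \<alpha> \<mu>)\<bar> * s powr \<alpha> \<mu> \<le> (\<bar>a \<mu>0\<bar> + 1) * s powr \<alpha> \<mu>"
        by (intro mult_right_mono) auto
      moreover have "\<bar>g \<mu> s * s powr (- \<alpha> \<mu>)\<bar> * s powr \<alpha> \<mu> = \<bar>g \<mu> s\<bar>"
        using \<open>s > 0\<close> by (simp add: abs_mult powr_minus field_simps)
      ultimately show "\<bar>g \<mu> s\<bar> \<le> (\<bar>a \<mu>0\<bar> + 1) * s powr \<alpha> \<mu>" by simp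
    qed
  qed
  with K(1) show thesis by (intro that[of K "\<bar>a \<mu>0\<bar> + 1"]) auto
qed

lemma continuous_family_on_tendsto:
  assumes "continuous_family_on U g" "open U" "\<mu>0 \<in> U" "x \<ge> 0"
  shows "((\<lambda>\<mu>. g \<mu> x) \<longlongrightarrow> g \<mu>0 x) (nhds \<mu>0)"
proof -
  have "continuous_on U (\<lambda>\<mu>. (\<lambda>(x, \<mu>). g \<mu> x) (x, \<mu>))"
    by (rule continuous_on_compose2[OF assms(1)[unfolded continuous_family_on_def]])
      (use assms in \<open>auto intro!: continuous_intros\<close>)
  then have "((\<lambda>\<mu>. g \<mu> x) \<longlongrightarrow> g \<mu>0 x) (at \<mu>0 within U)"
    using assms by (auto simp: continuous_on_def)
  then have "((\<lambda>\<mu>. g \<mu> x) \<longlongrightarrow> g \<mu>0 x) (at \<mu>0)"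
    using assms at_within_open[of \<mu>0 U] by simp
  then show ?thesis
    using tendsto_at_iff_tendsto_nhds[of "\<lambda>\<mu>. g \<mu> x" \<mu>0] by simp
qed

text \<open>No continuity of the exponent is assumed: it is recovered by comparing \<open>g \<mu> x\<close> with \<open>g \<mu>0 x\<close>
  at one large \<open>x\<close>, where a change of the exponent by \<open>e\<close> would produce a factor larger than 8.\<close>

lemma quantified_by_power_exponent_tendsto:
  assumes qp: "quantified_by_power g a \<alpha> \<mu>0"
  shows "(\<alpha> \<longlongrightarrow> \<alpha> \<mu>0) (nhds \<mu>0)"
proof (rule tendstoI)
  fix e :: real assume "e > 0"
  define c where "c = \<bar>a \<mu>0\<bar>"
  have "c > 0" using qp by (simp add: c_def quantified_by_power_def)
  obtain U where U: "open U" "\<mu>0 \<in> U" "continuous_family_on U g"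
    using qp by (auto simp: quantified_by_power_def)
  obtain K where K: "K \<ge> 1"
    "\<forall>\<^sub>F \<mu> in nhds \<mu>0. \<forall>s\<ge>K. \<bar>g \<mu> s * s powr (- \<alpha> \<mu>) - a \<mu>0\<bar> < c / 2"
    using quantified_by_power_uniform[OF qp, of "c / 2"] \<open>c > 0\<close> by auto
  \<comment> \<open>The choice makes x^e larger than 8, and the added 1 makes this strict and gives
    x > 1.\<close>
  define x where "x = max K (8 powr (1 / e)) + 1"
  have "x > 1" "x \<ge> K" using K by (auto simp: x_def)
  have "8 = (8 powr (1 / e)) powr e" using \<open>e > 0\<close> by (simp add: powr_powr)
  also have "\<dots> < x powr e" using \<open>e > 0\<close> by (intro powr_less_mono2) (auto simp: x_def)
  finally have x8: "8 < x powr e" .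
  define q where "q \<mu> = \<bar>g \<mu> x\<bar> * x powr (- \<alpha> \<mu>)" for \<mu>
  have q: "\<forall>\<^sub>F \<mu> in nhds \<mu>0. c / 2 < q \<mu> \<and> q \<mu> < 2 * c"
    using K(2)
  proof eventually_elim
    case (elim \<mu>)
    have "q \<mu> = \<bar>g \<mu> x * x powr (- \<alpha> \<mu>)\<bar>" by (simp add: q_def abs_mult)
    moreover have "\<bar>g \<mu> x * x powr (- \<alpha> \<mu>) - a \<mu>0\<bar> < c / 2" using elim \<open>x \<ge> K\<close> by blast
    ultimately show ?case unfolding c_def by linarith
  qed
  then have q0: "c / 2 < q \<mu>0" "q \<mu>0 < 2 * c" by (auto dest: eventually_nhds_x_imp_x)
  then have "g \<mu>0 x \<noteq> 0" using \<open>c > 0\<close> by (auto simp: q_def)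
  have "((\<lambda>\<mu>. \<bar>g \<mu> x\<bar>) \<longlongrightarrow> \<bar>g \<mu>0 x\<bar>) (nhds \<mu>0)"
    by (intro tendsto_rabs continuous_family_on_tendsto[OF U(3,1,2)]) (use \<open>x > 1\<close> in simp)
  then have "\<forall>\<^sub>F \<mu> in nhds \<mu>0. \<bar>g \<mu> x\<bar> > \<bar>g \<mu>0 x\<bar> / 2" "\<forall>\<^sub>F \<mu> in nhds \<mu>0. \<bar>g \<mu> x\<bar> < 2 * \<bar>g \<mu>0 x\<bar>"
    by (rule order_tendstoD; use \<open>g \<mu>0 x \<noteq> 0\<close> in simp)+
  with q show "\<forall>\<^sub>F \<mu> in nhds \<mu>0. dist (\<alpha> \<mu>) (\<alpha> \<mu>0) < e"
  proof eventually_elim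
    case (elim \<mu>)
    \<comment> \<open>A is \<open>q \<mu>\<close> with the exponent frozen at \<open>\<mu>0\<close>.
      Continuity in \<mu> at this x keeps A within a factor 2 of \<open>q \<mu>0\<close>, hence
      between c/4 and 4c. Since \<open>q \<mu>\<close> lies between c/2 and 2c, the quotient
      x^(\<open>\<alpha> \<mu>0 - \<alpha> \<mu>\<close>) lies between 1/8 and 8.\<close>
    define A where "A = \<bar>g \<mu> x\<bar> * x powr (- \<alpha> \<mu>0)"
    have y: "x powr (- \<alpha> \<mu>0) > 0" using \<open>x > 1\<close> by simp
    have "q \<mu>0 / 2 < A" "A < 2 * q \<mu>0"
      using elim y by (auto simp: A_def q_def field_simps)
    then have A: "c / 4 < A" "A < 4 * c" using q0 by auto
    have "A * x powr (\<alpha> \<mu>0 - \<alpha> \<mu>) = q \<mu>"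
      unfolding A_def q_def mult.assoc powr_add[symmetric] by simp
    then have r: "A * x powr (\<alpha> \<mu>0 - \<alpha> \<mu>) < 2 * c" "c / 2 < A * x powr (\<alpha> \<mu>0 - \<alpha> \<mu>)"
      using elim by auto
    have "\<alpha> \<mu>0 - \<alpha> \<mu> < e"
    proof (rule ccontr)
      assume "\<not> \<alpha> \<mu>0 - \<alpha> \<mu> < e"
      then have "x powr e \<le> x powr (\<alpha> \<mu>0 - \<alpha> \<mu>)" using \<open>x > 1\<close> by (intro powr_mono) auto
      then have "8 \<le> x powr (\<alpha> \<mu>0 - \<alpha> \<mu>)" using x8 by simp
      then have "(c / 4) * 8 \<le> A * x powr (\<alpha> \<mu>0 - \<alpha> \<mu>)"
        using A \<open>c > 0\<close> by (intro mult_mono) auto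
      then show False using r by simp
    qed
    moreover have "\<alpha> \<mu> - \<alpha> \<mu>0 < e"
    proof (rule ccontr)
      assume "\<not> \<alpha> \<mu> - \<alpha> \<mu>0 < e"
      then have "x powr (\<alpha> \<mu>0 - \<alpha> \<mu>) \<le> x powr (- e)" using \<open>x > 1\<close> by (intro powr_mono) auto
      also have "\<dots> \<le> 1 / 8" using x8 \<open>x > 1\<close> by (simp add: powr_minus field_simps)
      finally have "A * x powr (\<alpha> \<mu>0 - \<alpha> \<mu>) \<le> (4 * c) * (1 / 8)"
        using A \<open>c > 0\<close> by (intro mult_mono) auto
      then show False using r by simp
    qed
    ultimately show ?case by (simp add: dist_real_def abs_less_iff)
  qed
qed

text \<open>Closed balls in a Heine-Borel parameter space are compact, so joint continuity on {0..K}
  times a small closed ball gives one bound for all nearby parameters.\<close>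

lemma continuous_family_on_bounded:
  fixes g :: "'p::heine_borel \<Rightarrow> real \<Rightarrow> real"
  assumes "continuous_family_on U g" "open U" "\<mu>0 \<in> U"
  obtains C where "C \<ge> 0" "\<forall>\<^sub>F \<mu> in nhds \<mu>0. \<forall>s\<in>{0..K}. \<bar>g \<mu> s\<bar> \<le> C"
proof -
  obtain r where r: "r > 0" "cball \<mu>0 r \<subseteq> U"
    using assms open_contains_cball by blast
  have "compact ((\<lambda>(x, \<mu>). g \<mu> x) ` ({0..K} \<times> cball \<mu>0 r))"
    by (intro compact_continuous_image compact_Times continuous_on_subset[OF
          assms(1)[unfolded continuous_family_on_def]]) (use r in auto)
  then obtain C where C: "\<And>y. y \<in> (\<lambda>(x, \<mu>). g \<mu> x) ` ({0..K} \<times> cball \<mu>0 r) \<Longrightarrow> norm y \<le> C"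
    using compact_imp_bounded bounded_iff by metis
  have "\<forall>\<^sub>F \<mu> in nhds \<mu>0. \<mu> \<in> ball \<mu>0 r"
    using r by (intro eventually_nhds_in_open) auto
  then have "\<forall>\<^sub>F \<mu> in nhds \<mu>0. \<forall>s\<in>{0..K}. \<bar>g \<mu> s\<bar> \<le> max 0 C"
  proof eventually_elim
    case (elim \<mu>)
    show ?case
    proof
      fix s assume "s \<in> {0..K}"
      then have "norm (g \<mu> s) \<le> C" using elim by (intro C) force
      then show "\<bar>g \<mu> s\<bar> \<le> max 0 C" by simp
    qed
  qed
  then show thesis using that[of "max 0 C"] by simp
qed

lemma continuous_family_on_continuous:
  assumes "continuous_family_on U g" "\<mu> \<in> U"
  shows "continuous_on {0..} (g \<mu>)"
proof -
  have "continuous_on {0..} (\<lambda>x. (\<lambda>(x, \<mu>). g \<mu> x) (x, \<mu>))"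
    by (rule continuous_on_compose2[OF assms(1)[unfolded continuous_family_on_def]])
      (use assms in \<open>auto intro!: continuous_intros\<close>)
  then show ?thesis by simp
qed

lemma filterlim_compensator_along:
  assumes "(\<beta> \<longlongrightarrow> -1) (nhds \<mu>0)"
  shows "filterlim (\<lambda>(x, \<mu>). compensator x (\<beta> \<mu>)) at_top (at_top \<times>\<^sub>F nhds \<mu>0)"
proof -
  have "filterlim (\<lambda>p. (fst p, \<beta> (snd p))) (at_top \<times>\<^sub>F nhds (-1)) (at_top \<times>\<^sub>F nhds \<mu>0)"
    by (intro filterlim_Pair filterlim_fst filterlim_compose[OF assms filterlim_snd])
  from filterlim_compose[OF filterlim_compensator this] show ?thesis
    by (simp add: case_prod_unfold)
qed

text \<open>With \<omega> the compensator, x^(\<beta>+1) = 1 + (\<beta>+1) \<omega>, so the quotient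
  is (D + C)/\<omega> + C (\<beta>+1). The first term vanishes because \<omega> tends to infinity,
  the second because \<beta> tends to -1.\<close>

lemma negligible_compensator:
  assumes "(\<beta> \<longlongrightarrow> -1) (nhds \<mu>0)"
  shows "((\<lambda>(x, \<mu>). (D + C * x powr (\<beta> \<mu> + 1)) / compensator x (\<beta> \<mu>)) \<longlongrightarrow> 0) (at_top \<times>\<^sub>F nhds \<mu>0)"
proof -
  let ?P = "at_top \<times>\<^sub>F nhds \<mu>0"
  let ?\<omega> = "\<lambda>p. compensator (fst p) (\<beta> (snd p))"
  have \<omega>: "filterlim ?\<omega> at_top ?P"
    using filterlim_compensator_along[OF assms] by (simp add: case_prod_unfold)
  have \<beta>: "((\<lambda>p. \<beta> (snd p)) \<longlongrightarrow> -1) ?P"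
    by (rule filterlim_compose[OF assms filterlim_snd])
  have "((\<lambda>p. (D + C) * inverse (?\<omega> p) + C * (\<beta> (snd p) + 1)) \<longlongrightarrow> (D + C) * 0 + C * (-1 + 1)) ?P"
    by (intro tendsto_intros \<beta> filterlim_compose[OF tendsto_inverse_0_at_top \<omega>] tendsto_inverse_0_at_top[OF \<omega>])
  then have "((\<lambda>p. (D + C) * inverse (?\<omega> p) + C * (\<beta> (snd p) + 1)) \<longlongrightarrow> 0) ?P" by simp
  moreover have "\<forall>\<^sub>F p in ?P. (D + C) * inverse (?\<omega> p) + C * (\<beta> (snd p) + 1) =
      (case p of (x, \<mu>) \<Rightarrow> (D + C * x powr (\<beta> \<mu> + 1)) / compensator x (\<beta> \<mu>))"
    using filterlim_at_top_dense[THEN iffD1, OF \<omega>, rule_format, of 0]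
      filterlim_at_top_dense[THEN iffD1, OF filterlim_fst, rule_format, of 0]
  proof eventually_elim
    case (elim p)
    then have "fst p powr (\<beta> (snd p) + 1) = 1 + (\<beta> (snd p) + 1) * ?\<omega> p"
      by (intro powr_eq_compensator)
    then show ?case using elim by (simp only: case_prod_unfold) (simp add: field_simps)
  qed
  ultimately show ?thesis by (rule Lim_transform_eventually)
qed

lemma eventually_prod_at_top_nhds:
  assumes "\<forall>\<^sub>F \<mu> in nhds \<mu>0. Q \<mu>"
  shows "\<forall>\<^sub>F p in at_top \<times>\<^sub>F nhds \<mu>0. fst p \<ge> (K::real) \<and> Q (snd p)"
  by (rule eventually_prodI[OF eventually_ge_at_top assms])

section \<open>Size of each term of the expansion\<close>

text \<open>The integral is split at K. Below K a crude bound suffices; above K the integrand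
  differs from a s^\<beta> by at most e s^\<beta>, and s^\<beta> integrates to a difference of two
  compensators.\<close>

lemma principal_moment_bound:
  assumes g: "continuous_on {0..} g" and K: "1 \<le> K" "K \<le> x"
    and C: "\<And>s. s \<in> {0..K} \<Longrightarrow> \<bar>g s\<bar> \<le> C"
    and tail: "\<And>s. s \<ge> K \<Longrightarrow> \<bar>g s * s powr (- \<alpha>) - a\<bar> \<le> e" and "e \<ge> 0"
    and \<beta>: "\<beta> = \<alpha> + real j" "\<beta> \<le> 0"
  shows "\<bar>integral {0..x} (\<lambda>s. s ^ j * g s) - a * compensator x \<beta>\<bar> \<le>
    (K ^ j * C + \<bar>a\<bar>) * K + e * compensator x \<beta>"
proof -
  define \<phi> where "\<phi> = (\<lambda>s. s ^ j * g s)"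
  have \<phi>: "continuous_on {0..} \<phi>" unfolding \<phi>_def by (intro continuous_intros g)
  have split: "integral {0..K} \<phi> + integral {K..x} \<phi> = integral {0..x} \<phi>"
    using K by (intro Henstock_Kurzweil_Integration.integral_combine integrable_continuous_real
        continuous_on_subset[OF \<phi>]) auto
  have "norm (integral {0..K} \<phi>) \<le> integral {0..K} (\<lambda>_. K ^ j * C)"
  proof (rule integral_norm_bound_integral)
    show "\<phi> integrable_on {0..K}"
      by (intro integrable_continuous_real continuous_on_subset[OF \<phi>]) auto
    fix s assume s: "s \<in> {0..K}"
    then show "norm (\<phi> s) \<le> K ^ j * C"
      unfolding \<phi>_def using C[OF s] K
      by (auto simp: abs_mult power_abs intro!: mult_mono power_mono)
  qed (intro integrable_continuous_real continuous_intros)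
  then have 1: "\<bar>integral {0..K} \<phi>\<bar> \<le> K ^ j * C * K" using K by (simp add: mult_ac)
  have intw: "(\<lambda>s. s powr \<beta>) integrable_on {K..x}"
    by (intro integrable_continuous_real continuous_intros) (use K in auto)
  have \<omega>: "integral {1..y} (\<lambda>s. s powr \<beta>) = compensator y \<beta>" if "y \<ge> 1" for y
    using has_integral_compensator[OF that] by (rule integral_unique)
  have "integral {1..K} (\<lambda>s. s powr \<beta>) + integral {K..x} (\<lambda>s. s powr \<beta>) = integral {1..x} (\<lambda>s. s powr \<beta>)"
    using K by (intro Henstock_Kurzweil_Integration.integral_combine
        has_integral_integrable[OF has_integral_compensator]) auto
  then have W: "integral {K..x} (\<lambda>s. s powr \<beta>) = compensator x \<beta> - compensator K \<beta>"
    using K by (simp add: \<omega>)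
  \<comment> \<open>For s at least 1 and \<beta> at most 0, s^\<beta> is at most 1, which bounds the
    compensator at K independently of \<beta>.\<close>
  have "((\<lambda>_. 1) has_integral K - 1) {1..K}"
    using has_integral_const_real[of "1::real" 1 K] K by simp
  then have "compensator K \<beta> \<le> K - 1"
    by (rule has_integral_le[OF has_integral_compensator[OF K(1)]])
      (use \<beta>(2) powr_mono[of \<beta> 0] in auto)
  moreover have "compensator K \<beta> \<ge> 0"
    by (rule has_integral_nonneg[OF has_integral_compensator[OF K(1)]]) auto
  ultimately have \<omega>K: "0 \<le> compensator K \<beta>" "compensator K \<beta> \<le> K" by auto
  have "norm (integral {K..x} (\<lambda>s. \<phi> s - a * s powr \<beta>)) \<le> integral {K..x} (\<lambda>s. e * s powr \<beta>)"
  proof (rule integral_norm_bound_integral)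
    show "(\<lambda>s. \<phi> s - a * s powr \<beta>) integrable_on {K..x}"
      by (intro integrable_continuous_real continuous_intros continuous_on_subset[OF \<phi>]) (use K in auto)
    show "(\<lambda>s. e * s powr \<beta>) integrable_on {K..x}"
      by (intro integrable_continuous_real continuous_intros) (use K in auto)
    fix s assume s: "s \<in> {K..x}"
    then have "s > 0" using K by simp
    have "\<phi> s - a * s powr \<beta> = s powr \<beta> * (g s * s powr (- \<alpha>) - a)"
      using \<open>s > 0\<close> by (simp add: \<phi>_def \<beta> powr_add powr_realpow powr_minus field_simps)
    then have "norm (\<phi> s - a * s powr \<beta>) = s powr \<beta> * \<bar>g s * s powr (- \<alpha>) - a\<bar>"
      by (simp add: abs_mult)
    also have "\<dots> \<le> s powr \<beta> * e" using s by (intro mult_left_mono tail) auto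
    finally show "norm (\<phi> s - a * s powr \<beta>) \<le> e * s powr \<beta>" by (simp add: mult.commute)
  qed
  also have "integral {K..x} (\<lambda>s. e * s powr \<beta>) = e * (compensator x \<beta> - compensator K \<beta>)"
    by (simp add: W)
  also have "integral {K..x} (\<lambda>s. \<phi> s - a * s powr \<beta>) =
      integral {K..x} \<phi> - integral {K..x} (\<lambda>s. a * s powr \<beta>)"
    by (intro Henstock_Kurzweil_Integration.integral_diff integrable_continuous_real continuous_intros
        continuous_on_subset[OF \<phi>]) (use K in auto)
  also have "integral {K..x} (\<lambda>s. a * s powr \<beta>) = a * (compensator x \<beta> - compensator K \<beta>)"
    by (simp add: W)
  finally have 2: "\<bar>integral {K..x} \<phi> - a * (compensator x \<beta> - compensator K \<beta>)\<bar> \<le>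
      e * (compensator x \<beta> - compensator K \<beta>)" by simp
  have 3: "e * compensator K \<beta> \<ge> 0" using \<omega>K \<open>e \<ge> 0\<close> by simp
  have 4: "\<bar>a * compensator K \<beta>\<bar> \<le> \<bar>a\<bar> * K" using \<omega>K by (simp add: abs_mult mult_left_mono)
  show ?thesis
    using 1 2 3 4 split unfolding \<phi>_def[symmetric] distrib_right right_diff_distrib by linarith
qed

lemma principal_moment_tendsto:
  fixes g :: "'p::heine_borel \<Rightarrow> real \<Rightarrow> real"
  assumes qp: "quantified_by_power g a \<alpha> \<mu>0" and exponent: "\<alpha> \<mu>0 + real j = -1"
  shows "((\<lambda>(x, \<mu>). integral {0..x} (\<lambda>s. s ^ j * g \<mu> s) / compensator x (\<alpha> \<mu> + real j)) \<longlongrightarrow> a \<mu>0)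
    (at_top \<times>\<^sub>F nhds \<mu>0)"
proof (rule tendstoI)
  fix e :: real assume "e > 0"
  define \<beta> where "\<beta> \<mu> = \<alpha> \<mu> + real j" for \<mu>
  have \<beta>: "(\<beta> \<longlongrightarrow> -1) (nhds \<mu>0)"
    unfolding \<beta>_def exponent[symmetric]
    by (intro tendsto_intros quantified_by_power_exponent_tendsto[OF qp])
  obtain U where U: "open U" "\<mu>0 \<in> U" "continuous_family_on U g"
    using qp by (auto simp: quantified_by_power_def)
  obtain K where K: "K \<ge> 1"
    "\<forall>\<^sub>F \<mu> in nhds \<mu>0. \<forall>s\<ge>K. \<bar>g \<mu> s * s powr (- \<alpha> \<mu>) - a \<mu>0\<bar> < e / 2"
    using quantified_by_power_uniform[OF qp, of "e / 2"] \<open>e > 0\<close> by auto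
  obtain C where C: "\<forall>\<^sub>F \<mu> in nhds \<mu>0. \<forall>s\<in>{0..K}. \<bar>g \<mu> s\<bar> \<le> C"
    using continuous_family_on_bounded[OF U(3,1,2)] by blast
  \<comment> \<open>D does not depend on \<mu>, so it is negligible against the compensator and uses
    up one half of e; the other half is the relative error beyond K.\<close>
  define D where "D = (K ^ j * C + \<bar>a \<mu>0\<bar>) * K"
  have small: "\<forall>\<^sub>F p in at_top \<times>\<^sub>F nhds \<mu>0. D / compensator (fst p) (\<beta> (snd p)) < e / 2"
    using order_tendstoD(2)[OF negligible_compensator[OF \<beta>, of D 0], of "e / 2"] \<open>e > 0\<close>
    by (simp add: case_prod_unfold)
  have pos: "\<forall>\<^sub>F p in at_top \<times>\<^sub>F nhds \<mu>0. compensator (fst p) (\<beta> (snd p)) > 0"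
    using filterlim_compensator_along[OF \<beta>] by (simp add: filterlim_at_top_dense case_prod_unfold)
  have "\<forall>\<^sub>F \<mu> in nhds \<mu>0. \<mu> \<in> U" using U by (intro eventually_nhds_in_open)
  moreover have "\<forall>\<^sub>F \<mu> in nhds \<mu>0. \<beta> \<mu> < 0" by (rule order_tendstoD(2)[OF \<beta>]) simp
  ultimately have "\<forall>\<^sub>F \<mu> in nhds \<mu>0. \<mu> \<in> U \<and> \<beta> \<mu> < 0 \<and> (\<forall>s\<in>{0..K}. \<bar>g \<mu> s\<bar> \<le> C) \<and>
      (\<forall>s\<ge>K. \<bar>g \<mu> s * s powr (- \<alpha> \<mu>) - a \<mu>0\<bar> < e / 2)"
    using C K(2) by eventually_elim auto
  from eventually_prod_at_top_nhds[OF this, of K] small pos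
  have "\<forall>\<^sub>F p in at_top \<times>\<^sub>F nhds \<mu>0.
      dist (integral {0..fst p} (\<lambda>s. s ^ j * g (snd p) s) / compensator (fst p) (\<beta> (snd p))) (a \<mu>0) < e"
  proof eventually_elim
    case (elim p)
    define I where "I = integral {0..fst p} (\<lambda>s. s ^ j * g (snd p) s)"
    define w where "w = compensator (fst p) (\<beta> (snd p))"
    have "\<bar>I - a \<mu>0 * w\<bar> \<le> D + e / 2 * w"
      unfolding I_def w_def D_def
      by (rule principal_moment_bound[where \<alpha> = "\<alpha> (snd p)"])
        (use elim K(1) \<open>e > 0\<close> continuous_family_on_continuous[OF U(3)] in
          \<open>auto simp: \<beta>_def intro: less_imp_le\<close>)
    moreover have "w > 0" "D < e / 2 * w" using elim by (auto simp: w_def field_simps)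
    ultimately have "\<bar>I - a \<mu>0 * w\<bar> < e * w" by (simp add: algebra_simps)
    moreover have "I / w - a \<mu>0 = (I - a \<mu>0 * w) / w" using \<open>w > 0\<close> by (simp add: field_simps)
    ultimately show ?case
      using \<open>w > 0\<close> unfolding I_def[symmetric] w_def[symmetric] dist_real_def
      by (simp add: abs_divide pos_divide_less_eq)
  qed
  then show "\<forall>\<^sub>F p in at_top \<times>\<^sub>F nhds \<mu>0. dist (case p of (x, \<mu>) \<Rightarrow>
      integral {0..x} (\<lambda>s. s ^ j * g \<mu> s) / compensator x (\<alpha> \<mu> + real j)) (a \<mu>0) < e"
    by (simp add: case_prod_unfold \<beta>_def)
qed

lemma tendsto_zero_by_compensator:
  fixes h :: "real \<Rightarrow> 'p::topological_space \<Rightarrow> real"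
  assumes \<beta>: "(\<beta> \<longlongrightarrow> -1) (nhds \<mu>0)"
    and bound: "\<forall>\<^sub>F \<mu> in nhds \<mu>0. \<forall>x\<ge>K. \<bar>h x \<mu>\<bar> \<le> D + C * x powr (\<beta> \<mu> + 1)"
  shows "((\<lambda>(x, \<mu>). h x \<mu> / compensator x (\<beta> \<mu>)) \<longlongrightarrow> 0) (at_top \<times>\<^sub>F nhds \<mu>0)"
proof (rule Lim_null_comparison[OF _ negligible_compensator[OF \<beta>, of D C]])
  have "\<forall>\<^sub>F p in at_top \<times>\<^sub>F nhds \<mu>0. compensator (fst p) (\<beta> (snd p)) > 0"
    using filterlim_compensator_along[OF \<beta>] by (simp add: filterlim_at_top_dense case_prod_unfold)
  with eventually_prod_at_top_nhds[OF bound, of K]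
  show "\<forall>\<^sub>F p in at_top \<times>\<^sub>F nhds \<mu>0. norm (case p of (x, \<mu>) \<Rightarrow> h x \<mu> / compensator x (\<beta> \<mu>)) \<le>
      (case p of (x, \<mu>) \<Rightarrow> (D + C * x powr (\<beta> \<mu> + 1)) / compensator x (\<beta> \<mu>))"
  proof eventually_elim
    case (elim p)
    then have "\<bar>h (fst p) (snd p)\<bar> \<le> D + C * fst p powr (\<beta> (snd p) + 1)" by blast
    then show ?case using elim by (simp add: case_prod_unfold abs_divide divide_right_mono)
  qed
qed

text \<open>The tail bound makes the integral O(x^(\<alpha>+2k+1)), and the prefactor x^(2(m-k))
  raises every such term to the common order x^(\<alpha>+2m+1), which is negligible.\<close>

lemma vanishing_moment_tendsto:
  fixes g :: "'p::heine_borel \<Rightarrow> real \<Rightarrow> real"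
  assumes qp: "quantified_by_power g a \<alpha> \<mu>0" and exponent: "\<alpha> \<mu>0 + 2 * real m = -1"
    and V: "open V" "\<mu>0 \<in> V" and "k < m"
    and moment: "\<And>\<mu>. \<mu> \<in> V \<Longrightarrow> (\<lambda>s. s ^ (2*k) * g \<mu> s) integrable_on {0..}"
      "\<And>\<mu>. \<mu> \<in> V \<Longrightarrow> integral {0..} (\<lambda>s. s ^ (2*k) * g \<mu> s) = 0"
  shows "((\<lambda>(x, \<mu>). x ^ (2*(m-k)) * integral {0..x} (\<lambda>s. s ^ (2*k) * g \<mu> s) /
    compensator x (\<alpha> \<mu> + 2 * real m)) \<longlongrightarrow> 0) (at_top \<times>\<^sub>F nhds \<mu>0)"
proof -
  have \<beta>: "((\<lambda>\<mu>. \<alpha> \<mu> + 2 * real m) \<longlongrightarrow> -1) (nhds \<mu>0)"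
    unfolding exponent[symmetric]
    by (intro tendsto_intros quantified_by_power_exponent_tendsto[OF qp])
  obtain U where U: "open U" "\<mu>0 \<in> U" "continuous_family_on U g"
    using qp by (auto simp: quantified_by_power_def)
  obtain K C where KC: "K \<ge> 1" "C \<ge> 0"
    "\<forall>\<^sub>F \<mu> in nhds \<mu>0. \<forall>s\<ge>K. \<bar>g \<mu> s\<bar> \<le> C * s powr \<alpha> \<mu>"
    using quantified_by_power_bound[OF qp] by blast
  have ev: "\<forall>\<^sub>F \<mu> in nhds \<mu>0. \<mu> \<in> U" "\<forall>\<^sub>F \<mu> in nhds \<mu>0. \<mu> \<in> V"
    using U V by (auto intro: eventually_nhds_in_open)
  have "\<forall>\<^sub>F \<mu> in nhds \<mu>0. \<alpha> \<mu> + 2 * real m < 0" by (rule order_tendstoD(2)[OF \<beta>]) simp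
  with ev KC(3) have "\<forall>\<^sub>F \<mu> in nhds \<mu>0. \<forall>x\<ge>K. \<bar>x ^ (2*(m-k)) * integral {0..x} (\<lambda>s. s ^ (2*k) * g \<mu> s)\<bar> \<le>
      0 + C * x powr (\<alpha> \<mu> + 2 * real m + 1)"
  proof eventually_elim
    case (elim \<mu>)
    show ?case
    proof (intro allI impI)
      fix x assume x: "x \<ge> K"
      then have "x > 0" using KC by simp
      define p where "p = \<alpha> \<mu> + real (2*k) + 1"
      \<comment> \<open>Here 2k is at most 2m - 2 and \<alpha> + 2m < 0. Consequently the division
        by -p in the tail bound costs nothing, uniformly in \<mu>.\<close>
      have p: "p \<le> -1" using elim \<open>k < m\<close> by (simp add: p_def)
      have "\<bar>integral {0..x} (\<lambda>s. s ^ (2*k) * g \<mu> s)\<bar> \<le> C * x powr p / (- p)"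
        unfolding p_def
        by (rule integral_zero_tail_bound)
          (use elim x p \<open>x > 0\<close> moment continuous_family_on_continuous[OF U(3)] in \<open>auto simp: p_def\<close>)
      also have "\<dots> \<le> C * x powr p / 1"
        using p KC by (intro divide_left_mono) auto
      finally have "x ^ (2*(m-k)) * \<bar>integral {0..x} (\<lambda>s. s ^ (2*k) * g \<mu> s)\<bar> \<le> x ^ (2*(m-k)) * (C * x powr p)"
        using \<open>x > 0\<close> by (intro mult_left_mono) auto
      also have "\<dots> = C * x powr (real (2*(m-k)) + p)"
        unfolding powr_add powr_realpow[OF \<open>x > 0\<close>] by simp
      also have "real (2*(m-k)) + p = \<alpha> \<mu> + 2 * real m + 1"
        using \<open>k < m\<close> by (simp add: p_def of_nat_diff)
      finally show "\<bar>x ^ (2*(m-k)) * integral {0..x} (\<lambda>s. s ^ (2*k) * g \<mu> s)\<bar> \<le>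
          0 + C * x powr (\<alpha> \<mu> + 2 * real m + 1)"
        using \<open>x > 0\<close> by (simp add: abs_mult)
    qed
  qed
  then show ?thesis by (rule tendsto_zero_by_compensator[OF \<beta>])
qed

text \<open>The supremum of s^(2m+2) |g(s)| over s up to x is at most D + C x^(\<alpha>+2m+2): D
  covers s up to K, the power bound covers the rest. The factor 1/x brings this down to a constant
  plus a multiple of x^(\<alpha>+2m+1).\<close>

lemma expansion_error_tendsto:
  fixes g :: "'p::heine_borel \<Rightarrow> real \<Rightarrow> real"
  assumes qp: "quantified_by_power g a \<alpha> \<mu>0" and exponent: "\<alpha> \<mu>0 + 2 * real m = -1"
  shows "((\<lambda>(x, \<mu>). (x ^ (2*m+1) * F_op (g \<mu>) x -
    (\<Sum>k\<le>m. central_coeff k * (x ^ (2*(m-k)) * integral {0..x} (\<lambda>s. s ^ (2*k) * g \<mu> s)))) /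
    compensator x (\<alpha> \<mu> + 2 * real m)) \<longlongrightarrow> 0) (at_top \<times>\<^sub>F nhds \<mu>0)"
proof -
  have \<beta>: "((\<lambda>\<mu>. \<alpha> \<mu> + 2 * real m) \<longlongrightarrow> -1) (nhds \<mu>0)"
    unfolding exponent[symmetric]
    by (intro tendsto_intros quantified_by_power_exponent_tendsto[OF qp])
  obtain U where U: "open U" "\<mu>0 \<in> U" "continuous_family_on U g"
    using qp by (auto simp: quantified_by_power_def)
  obtain K C where KC: "K \<ge> 1" "C \<ge> 0"
    "\<forall>\<^sub>F \<mu> in nhds \<mu>0. \<forall>s\<ge>K. \<bar>g \<mu> s\<bar> \<le> C * s powr \<alpha> \<mu>"
    using quantified_by_power_bound[OF qp] by blast
  obtain C' where C': "C' \<ge> 0" "\<forall>\<^sub>F \<mu> in nhds \<mu>0. \<forall>s\<in>{0..K}. \<bar>g \<mu> s\<bar> \<le> C'"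
    using continuous_family_on_bounded[OF U(3,1,2)] by blast
  define D where "D = K ^ (2 * Suc m) * C'"
  have "D \<ge> 0" using KC C' by (simp add: D_def)
  have "\<forall>\<^sub>F \<mu> in nhds \<mu>0. \<mu> \<in> U" using U by (intro eventually_nhds_in_open)
  moreover have "\<forall>\<^sub>F \<mu> in nhds \<mu>0. \<alpha> \<mu> + 2 * real m > -2" by (rule order_tendstoD(1)[OF \<beta>]) simp
  ultimately have "\<forall>\<^sub>F \<mu> in nhds \<mu>0. \<forall>x\<ge>K. \<bar>x ^ (2*m+1) * F_op (g \<mu>) x -
      (\<Sum>k\<le>m. central_coeff k * (x ^ (2*(m-k)) * integral {0..x} (\<lambda>s. s ^ (2*k) * g \<mu> s)))\<bar> \<le>
      pi / 2 * D + pi / 2 * C * x powr (\<alpha> \<mu> + 2 * real m + 1)"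
    using KC(3) C'(2)
  proof eventually_elim
    case (elim \<mu>)
    show ?case
    proof (intro allI impI)
      fix x assume x: "x \<ge> K"
      then have "x \<ge> 1" using KC by simp
      \<comment> \<open>This exponent is 1 at \<open>\<mu>0\<close>, hence nonnegative nearby, so
        that s^b is largest at s = x.\<close>
      define b where "b = \<alpha> \<mu> + 2 * real m + 2"
      have "b \<ge> 0" using elim by (simp add: b_def)
      have "\<bar>x ^ (2*m+1) * F_op (g \<mu>) x -
          (\<Sum>k\<le>m. central_coeff k * (x ^ (2*(m-k)) * integral {0..x} (\<lambda>s. s ^ (2*k) * g \<mu> s)))\<bar> \<le>
          pi / 2 * (D + C * x powr b) / x"
      proof (rule F_op_expansion)
        show "continuous_on {0..} (g \<mu>)"
          using elim by (intro continuous_family_on_continuous[OF U(3)]) auto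
        fix s assume s: "s \<in> {0..x}"
        show "s ^ (2 * Suc m) * \<bar>g \<mu> s\<bar> \<le> D + C * x powr b"
        proof (cases "s \<le> K")
          case True
          then have "s ^ (2 * Suc m) * \<bar>g \<mu> s\<bar> \<le> D"
            unfolding D_def using s elim KC by (intro mult_mono power_mono) auto
          moreover have "C * x powr b \<ge> 0" using KC by simp
          ultimately show ?thesis by simp
        next
          case False
          then have "s > 0" "s \<ge> K" using KC by auto
          have "s ^ (2 * Suc m) * \<bar>g \<mu> s\<bar> \<le> s ^ (2 * Suc m) * (C * s powr \<alpha> \<mu>)"
            using elim \<open>s \<ge> K\<close> \<open>s > 0\<close> by (intro mult_left_mono) auto
          also have "\<dots> = C * s powr (real (2 * Suc m) + \<alpha> \<mu>)"
            unfolding powr_add powr_realpow[OF \<open>s > 0\<close>] by simp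
          also have "real (2 * Suc m) + \<alpha> \<mu> = b" by (simp add: b_def)
          also have "C * s powr b \<le> C * x powr b"
            using s \<open>s > 0\<close> \<open>b \<ge> 0\<close> KC by (intro mult_left_mono powr_mono2) auto
          finally show ?thesis using \<open>D \<ge> 0\<close> by simp
        qed
      qed (use \<open>x \<ge> 1\<close> in auto)
      also have "\<dots> = pi / 2 * (D / x) + pi / 2 * C * (x powr b / x)"
        by (simp add: add_divide_distrib distrib_left)
      also have "x powr b / x = x powr (\<alpha> \<mu> + 2 * real m + 1)"
      proof -
        have eq: "\<alpha> \<mu> + 2 * real m + 1 = b - 1" by (simp add: b_def)
        show ?thesis unfolding eq
          using \<open>x \<ge> 1\<close> by (simp add: powr_diff)
      qed
      also have "D / x \<le> D" using \<open>x \<ge> 1\<close> \<open>D \<ge> 0\<close> by (simp add: divide_le_eq mult_le_cancel_left1)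
      finally show "\<bar>x ^ (2*m+1) * F_op (g \<mu>) x -
          (\<Sum>k\<le>m. central_coeff k * (x ^ (2*(m-k)) * integral {0..x} (\<lambda>s. s ^ (2*k) * g \<mu> s)))\<bar> \<le>
          pi / 2 * D + pi / 2 * C * x powr (\<alpha> \<mu> + 2 * real m + 1)" by simp
    qed
  qed
  then show ?thesis by (rule tendsto_zero_by_compensator[OF \<beta>])
qed

section \<open>Assembly\<close>

lemma continuous_family_on_F_op:
  fixes g :: "'p::t2_space \<Rightarrow> real \<Rightarrow> real"
  assumes "continuous_family_on U g"
  shows "continuous_family_on U (\<lambda>\<mu>. F_op (g \<mu>))"
proof -
  have "continuous_on (({0..} \<times> U) \<times> cbox 0 (pi/2))
      (\<lambda>q. (\<lambda>(x, \<mu>). g \<mu> x) (fst (fst q) * sin (snd q), snd (fst q)))"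
    by (rule continuous_on_compose2[OF assms[unfolded continuous_family_on_def]], intro continuous_intros)
      (auto intro!: mult_nonneg_nonneg sin_nonneg_quarter)
  then have "continuous_on (({0..} \<times> U) \<times> cbox 0 (pi/2)) (\<lambda>(p, \<theta>). g (snd p) (fst p * sin \<theta>))"
    by (simp add: case_prod_unfold)
  from integral_continuous_on_param[OF this] show ?thesis
    by (simp add: continuous_family_on_def F_op_def case_prod_unfold)
qed

text \<open>After division by the compensator, the expansion error and the terms with k < m vanish
  in the limit, and the term k = m, whose prefactor is x^0, leaves
  \<open>central_coeff m * a \<mu>0\<close>.\<close>

lemma F_op_quantified_by_Omega:
  fixes g :: "'p::heine_borel \<Rightarrow> real \<Rightarrow> real"
  assumes qp: "quantified_by_power g a \<alpha> \<mu>0" and exponent: "\<alpha> \<mu>0 + 2 * real m = -1"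
    and V: "open V" "\<mu>0 \<in> V"
    and momenta: "\<forall>i\<in>{1..m}. \<forall>\<mu>\<in>V. momentum_exists i (g \<mu>) \<and> momentum i (g \<mu>) = 0"
  shows "quantified_by_Omega (\<lambda>\<mu> x. x ^ (2 * m + 1) * F_op (g \<mu>) x)
    (\<lambda>\<mu>. a \<mu> * b_coeff m (\<alpha> \<mu>)) (\<lambda>\<mu>. \<alpha> \<mu> + 2 * real m) \<mu>0"
proof -
  let ?P = "at_top \<times>\<^sub>F nhds \<mu>0"
  define \<beta> where "\<beta> \<mu> = \<alpha> \<mu> + 2 * real m" for \<mu>
  define I where "I k x \<mu> = x ^ (2*(m-k)) * integral {0..x} (\<lambda>s. s ^ (2*k) * g \<mu> s)" for k x \<mu>
  have \<beta>: "(\<beta> \<longlongrightarrow> -1) (nhds \<mu>0)"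
    unfolding exponent[symmetric] \<beta>_def
    by (intro tendsto_intros quantified_by_power_exponent_tendsto[OF qp])
  obtain U where U: "open U" "\<mu>0 \<in> U" "continuous_family_on U g"
    using qp by (auto simp: quantified_by_power_def)
  have lower: "((\<lambda>p. I k (fst p) (snd p) / compensator (fst p) (\<beta> (snd p))) \<longlongrightarrow> 0) ?P" if "k < m" for k
  proof -
    \<comment> \<open>The momentum with index k + 1 carries the power 2(k+1) - 2 = 2k, and k < m
      places this index in 1..m.\<close>
    have "(\<lambda>s. s ^ (2*k) * g \<mu> s) integrable_on {0..}"
      "integral {0..} (\<lambda>s. s ^ (2*k) * g \<mu> s) = 0" if "\<mu> \<in> V" for \<mu>
      using momenta[rule_format, of "Suc k" \<mu>] \<open>k < m\<close> that
      by (simp_all add: momentum_exists_def momentum_def)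
    from vanishing_moment_tendsto[OF qp exponent V \<open>k < m\<close> this] show ?thesis
      by (simp add: I_def \<beta>_def case_prod_unfold)
  qed
  have top: "((\<lambda>p. I m (fst p) (snd p) / compensator (fst p) (\<beta> (snd p))) \<longlongrightarrow> a \<mu>0) ?P"
    using principal_moment_tendsto[OF qp, of "2 * m"] exponent
    by (simp add: I_def \<beta>_def case_prod_unfold)
  have "((\<lambda>p. \<Sum>k\<le>m. central_coeff k * (I k (fst p) (snd p) / compensator (fst p) (\<beta> (snd p)))) \<longlongrightarrow>
      (\<Sum>k\<le>m. central_coeff k * (if k < m then 0 else a \<mu>0))) ?P"
    by (intro tendsto_sum tendsto_mult tendsto_const) (use lower top in \<open>auto simp: not_less\<close>)
  also have "(\<Sum>k\<le>m. central_coeff k * (if k < m then 0 else a \<mu>0)) = central_coeff m * a \<mu>0"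
    by (simp add: lessThan_Suc_atMost[symmetric])
  finally have "((\<lambda>p. ((fst p) ^ (2*m+1) * F_op (g (snd p)) (fst p) -
      (\<Sum>k\<le>m. central_coeff k * I k (fst p) (snd p))) / compensator (fst p) (\<beta> (snd p)) +
      (\<Sum>k\<le>m. central_coeff k * (I k (fst p) (snd p) / compensator (fst p) (\<beta> (snd p))))) \<longlongrightarrow>
      0 + central_coeff m * a \<mu>0) ?P"
    by (rule tendsto_add[rotated])
      (use expansion_error_tendsto[OF qp exponent] in \<open>simp add: I_def \<beta>_def case_prod_unfold\<close>)
  then have "((\<lambda>p. (fst p) ^ (2*m+1) * F_op (g (snd p)) (fst p) / compensator (fst p) (\<beta> (snd p))) \<longlongrightarrow>
      central_coeff m * a \<mu>0) ?P"
    by (simp add: diff_divide_distrib sum_divide_distrib)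
  \<comment> \<open>\<open>Omega\<close> is the compensator times this factor; as the factor tends
    to 1, replacing the compensator by \<open>Omega\<close> leaves the limit unchanged.\<close>
  moreover have "((\<lambda>p. if \<beta> (snd p) = -1 then 1 else (\<beta> (snd p) + 1) * G_fun (\<beta> (snd p))) \<longlongrightarrow> 1) ?P"
    by (rule filterlim_compose[OF Omega_factor_tendsto filterlim_compose[OF \<beta> filterlim_snd]])
  ultimately have "((\<lambda>p. (fst p) ^ (2*m+1) * F_op (g (snd p)) (fst p) / compensator (fst p) (\<beta> (snd p)) /
      (if \<beta> (snd p) = -1 then 1 else (\<beta> (snd p) + 1) * G_fun (\<beta> (snd p)))) \<longlongrightarrow>
      central_coeff m * a \<mu>0 / 1) ?P"
    by (rule tendsto_divide) simp
  then have lim: "((\<lambda>p. (fst p) ^ (2*m+1) * F_op (g (snd p)) (fst p) / Omega (fst p) (\<beta> (snd p))) \<longlongrightarrow>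
      a \<mu>0 * b_coeff m (\<alpha> \<mu>0)) ?P"
    by (simp add: Omega_def b_coeff_eq_central_coeff[OF exponent] divide_divide_eq_left mult.commute)
  have "continuous_family_on U (\<lambda>\<mu> x. x ^ (2 * m + 1) * F_op (g \<mu>) x)"
    using continuous_family_on_F_op[OF U(3)]
    by (auto simp: continuous_family_on_def case_prod_unfold intro!: continuous_intros)
  moreover have "a \<mu>0 * b_coeff m (\<alpha> \<mu>0) \<noteq> 0"
    using qp central_coeff_pos[of m]
    by (simp add: quantified_by_power_def b_coeff_eq_central_coeff[OF exponent])
  ultimately show ?thesis
    unfolding quantified_by_Omega_def using U lim
    by (auto simp: \<beta>_def case_prod_unfold)
qed

text \<open>The two operators commute only at x \<ge> 0 and for parameters in an open set; the
  continuity clause, restricted to that set, and the limit see nothing beyond this.\<close>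

lemma quantified_by_Omega_cong:
  assumes "quantified_by_Omega F l \<beta> \<mu>0" "open W" "\<mu>0 \<in> W"
    and eq: "\<And>\<mu> x. \<mu> \<in> W \<Longrightarrow> x \<ge> 0 \<Longrightarrow> F \<mu> x = G \<mu> x"
  shows "quantified_by_Omega G l \<beta> \<mu>0"
proof -
  obtain U where U: "open U" "\<mu>0 \<in> U" "continuous_family_on U F"
    using assms(1) by (auto simp: quantified_by_Omega_def)
  have "continuous_family_on (U \<inter> W) F"
    using U(3) unfolding continuous_family_on_def by (rule continuous_on_subset) auto
  then have "continuous_family_on (U \<inter> W) G"
    unfolding continuous_family_on_def
    by (rule continuous_on_eq) (use eq in auto)
  moreover have "((\<lambda>(x, \<mu>). G \<mu> x / Omega x (\<beta> \<mu>)) \<longlongrightarrow> l \<mu>0) (at_top \<times>\<^sub>F nhds \<mu>0)"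
  proof (rule Lim_transform_eventually)
    show "((\<lambda>(x, \<mu>). F \<mu> x / Omega x (\<beta> \<mu>)) \<longlongrightarrow> l \<mu>0) (at_top \<times>\<^sub>F nhds \<mu>0)"
      using assms(1) by (simp add: quantified_by_Omega_def)
    have "\<forall>\<^sub>F \<mu> in nhds \<mu>0. \<mu> \<in> W" using assms by (intro eventually_nhds_in_open)
    from eventually_prod_at_top_nhds[OF this, of 0]
    show "\<forall>\<^sub>F p in at_top \<times>\<^sub>F nhds \<mu>0. (case p of (x, \<mu>) \<Rightarrow> F \<mu> x / Omega x (\<beta> \<mu>)) =
        (case p of (x, \<mu>) \<Rightarrow> G \<mu> x / Omega x (\<beta> \<mu>))"
      by eventually_elim (use eq in \<open>auto simp: case_prod_unfold\<close>)
  qed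
  ultimately show ?thesis
    unfolding quantified_by_Omega_def using assms U by (meson IntI open_Int quantified_by_Omega_def)
qed

theorem theorem4:
  fixes \<Lambda> V :: "(real ^ 'd) set"
    and f :: "real ^ 'd \<Rightarrow> real \<Rightarrow> real"
    and \<mu>0 :: "real ^ 'd"
    and n m :: nat
    and \<nu> :: "nat \<Rightarrow> real ^ 'd \<Rightarrow> real"
    and a \<alpha> :: "real ^ 'd \<Rightarrow> real"
    and \<nu>s :: "real ^ 'd \<Rightarrow> real list"
  defines "\<nu>s \<equiv> \<lambda>\<mu>. map (\<lambda>i. \<nu> i \<mu>) [1..<Suc n]"
  assumes "open \<Lambda>" and "\<mu>0 \<in> \<Lambda>"
    and "\<forall>\<mu>\<in>\<Lambda>. analytic_half_line (f \<mu>)"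
    and "continuous_family_on \<Lambda> f"
    and "open V" and "\<mu>0 \<in> V" and "V \<subseteq> \<Lambda>"
    and "\<forall>i\<in>{1..n}. continuous_on V (\<nu> i)"
    and "inj_on (\<lambda>i. \<nu> i \<mu>0) {1..n}"
    and "quantified_by_power (\<lambda>\<mu>. L_op (\<nu>s \<mu>) (f \<mu>)) a \<alpha> \<mu>0"
    and "\<alpha> \<mu>0 + 2 * real m = -1"
    and "\<forall>i\<in>{1..m}. \<forall>\<mu>\<in>V. momentum_exists i (L_op (\<nu>s \<mu>) (f \<mu>))
                          \<and> momentum i (L_op (\<nu>s \<mu>) (f \<mu>)) = 0"
  shows "quantified_by_Omega
           (\<lambda>\<mu> x. x ^ (2 * m + 1) * (L_op (\<nu>s \<mu>) \<circ> F_op) (f \<mu>) x)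
           (\<lambda>\<mu>. a \<mu> * b_coeff m (\<alpha> \<mu>))
           (\<lambda>\<mu>. \<alpha> \<mu> + 2 * real m)
           \<mu>0"
proof (rule quantified_by_Omega_cong)
  show "quantified_by_Omega (\<lambda>\<mu> x. x ^ (2 * m + 1) * F_op (L_op (\<nu>s \<mu>) (f \<mu>)) x)
      (\<lambda>\<mu>. a \<mu> * b_coeff m (\<alpha> \<mu>)) (\<lambda>\<mu>. \<alpha> \<mu> + 2 * real m) \<mu>0"
    by (rule F_op_quantified_by_Omega) fact+
  show "open \<Lambda>" "\<mu>0 \<in> \<Lambda>" by fact+
  show "x ^ (2 * m + 1) * F_op (L_op (\<nu>s \<mu>) (f \<mu>)) x = x ^ (2 * m + 1) * (L_op (\<nu>s \<mu>) \<circ> F_op) (f \<mu>) x"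
    if "\<mu> \<in> \<Lambda>" "x \<ge> 0" for \<mu> x
    using L_op_F_op[of "f \<mu>" x "\<nu>s \<mu>"] assms that by simp
qed

end
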